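(* Let $v=pq$ or $v=p^n$, where $p,q$ are primes and $n\ge 1$. Then any two balanced cyclic configurations with point set $\mathbb{Z}_v$ are isomorphic if and only if they are multiplier equivalent.
   Context: A configuration of type $(v_k)$ (balanced configuration) is a pair $(P,\mathcal{B})$ with $|P|=|\mathcal{B}|=v$, lines being subsets of $P$, any two distinct lines meeting in at most one point, every line containing exactly $k\ge 3$ points and every point lying on exactly $k$ lines. An isomorphism is a bijection of point sets mapping lines onto lines. A balanced cyclic configuration on $\mathbb{Z}_v$ is such a configuration with point set $\mathbb{Z}_v$ for which the translation $x\mapsto x+1$ is an automorphism. Two such configurations are multiplier equivalent if there is a unit $a\in\mathbb{Z}_v^*$ such that $x\mapsto ax$ is an isomorphism between them. *)

theory Defs
  imports "HOL-Number_Theory.Residues"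
begin

definition balanced_configuration :: "nat \<Rightarrow> nat \<Rightarrow> 'a set \<Rightarrow> 'a set set \<Rightarrow> bool" where
  "balanced_configuration v k P \<B> \<longleftrightarrow>
     finite P \<and> card P = v \<and> card \<B> = v \<and> k \<ge> 3 \<and>
     (\<forall>L\<in>\<B>. L \<subseteq> P) \<and>
     (\<forall>L\<in>\<B>. \<forall>M\<in>\<B>. L \<noteq> M \<longrightarrow> card (L \<inter> M) \<le> 1) \<and>
     (\<forall>L\<in>\<B>. card L = k) \<and>
     (\<forall>x\<in>P. card {L\<in>\<B>. x \<in> L} = k)"

definition configuration_isomorphism ::
    "'a set \<Rightarrow> 'a set set \<Rightarrow> 'b set \<Rightarrow> 'b set set \<Rightarrow> ('a \<Rightarrow> 'b) \<Rightarrow> bool" where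
  "configuration_isomorphism P \<B> Q \<C> f \<longleftrightarrow>
     bij_betw f P Q \<and> (\<lambda>L. f ` L) ` \<B> = \<C>"

definition isomorphic_configurations ::
    "'a set \<Rightarrow> 'a set set \<Rightarrow> 'b set \<Rightarrow> 'b set set \<Rightarrow> bool" where
  "isomorphic_configurations P \<B> Q \<C> \<longleftrightarrow> (\<exists>f. configuration_isomorphism P \<B> Q \<C> f)"

abbreviation Zmod :: "nat \<Rightarrow> int ring" where
  "Zmod v \<equiv> residue_ring (int v)"

text \<open>
  Only the line set is an argument, since the point set is the carrier of \<open>Zmod v\<close>.
  The line size \<open>k\<close> is existential, so two configurations on the same points may have
  different line sizes.
\<close>

definition balanced_cyclic_configuration :: "nat \<Rightarrow> int set set \<Rightarrow> bool" where
  "balanced_cyclic_configuration v \<B> \<longleftrightarrow>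
     (\<exists>k. balanced_configuration v k (carrier (Zmod v)) \<B>) \<and>
     configuration_isomorphism (carrier (Zmod v)) \<B> (carrier (Zmod v)) \<B>
       (\<lambda>x. x \<oplus>\<^bsub>Zmod v\<^esub> \<one>\<^bsub>Zmod v\<^esub>)"

definition multiplier_equivalent :: "nat \<Rightarrow> int set set \<Rightarrow> int set set \<Rightarrow> bool" where
  "multiplier_equivalent v \<B> \<C> \<longleftrightarrow>
     (\<exists>a\<in>Units (Zmod v).
        configuration_isomorphism (carrier (Zmod v)) \<B> (carrier (Zmod v)) \<C>
          (\<lambda>x. a \<otimes>\<^bsub>Zmod v\<^esub> x))"

end

theory Submission
  imports Defs
    "HOL-Algebra.Sylow"
    "HOL-Algebra.Group_Action"
    "HOL-Algebra.Multiplicative_Group"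
    "HOL-Computational_Algebra.Group_Closure"
begin

text \<open>
  A balanced cyclic configuration is the set of all translates of one base line \<open>S\<close>, and \<open>S\<close> is a
  Sidon set: a nonzero difference of elements of \<open>S\<close> arises only once. An isomorphism
  onto another such configuration conjugates the translation group into a second regular cyclic subgroup of
  the automorphism group \<open>A\<close> of the first; if the two subgroups are conjugate in \<open>A\<close>, the
  isomorphism can be corrected by an automorphism so as to normalise the translations, that is, to be affine.

  Dividing by the gcd of the differences of \<open>S\<close> reduces to the case where these differences
  generate \<open>\<int>\<^sub>v\<close>. Then the Sidon property forces every automorphism that maps each coset of a
  subgroup \<open>H\<close> to itself and acts on it as a translation, on points and on lines, to be a
  global translation.

  For \<open>v = p q\<close> with \<open>p < q\<close> a Sylow \<open>q\<close>-subgroup containing the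
  translations of order \<open>q\<close> has orbits of size less than \<open>q\<^sup>2\<close>, so it
  consists of translations only; inside the centraliser of that subgroup, Sylow's theorem for \<open>p\<close>
  finishes the conjugation. For \<open>v = p\<^sup>n\<close> a Sylow \<open>p\<close>-subgroup \<open>P\<close> containing
  the translations centralises the translations of order \<open>p\<close>. For an affine element of
  \<open>P\<close> of order \<open>v\<close> other than a translation, some power of its linear part would be multiplication by
  \<open>1 + u p\<^bsup>n-1\<^esup>\<close>, which fixes the cosets of the subgroup of order \<open>p\<close> without being a
  translation. So the translations are the only affine cyclic subgroup of order \<open>v\<close> in
  \<open>P\<close>, and since normalisers grow in \<open>p\<close>-groups, all of \<open>P\<close> is affine.
\<close>

section \<open>Actions of finite groups of prime power order\<close>

text \<open>Only the values on \<open>E\<close> are constrained, so \<open>fst\<close>,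
  \<open>snd\<close> and their reductions modulo \<open>e\<close> are actions as they stand.
  \<open>group_action_restrict\<close> passes to the extensional notion in order to reach the
  orbit-stabiliser theorem.\<close>

locale set_action = group G for G (structure) +
  fixes E :: "'e set" and \<phi> :: "'a \<Rightarrow> 'e \<Rightarrow> 'e"
  assumes act_closed: "\<lbrakk>g \<in> carrier G; x \<in> E\<rbrakk> \<Longrightarrow> \<phi> g x \<in> E"
    and act_mult: "\<lbrakk>g \<in> carrier G; h \<in> carrier G; x \<in> E\<rbrakk> \<Longrightarrow> \<phi> (g \<otimes> h) x = \<phi> g (\<phi> h x)"
    and act_one: "x \<in> E \<Longrightarrow> \<phi> \<one> x = x"
begin

lemma act_inv:
  assumes "g \<in> carrier G" "x \<in> E"
  shows "\<phi> (inv g) (\<phi> g x) = x" "\<phi> g (\<phi> (inv g) x) = x"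
  using assms act_mult[of "inv g" g x] act_mult[of g "inv g" x] by (simp_all add: act_one)

lemma act_bij: "g \<in> carrier G \<Longrightarrow> bij_betw (\<phi> g) E E"
  by (rule bij_betwI[where g = "\<phi> (inv g)"]) (auto simp: act_closed act_inv)

lemma group_action_restrict: "group_action G E (\<lambda>g. restrict (\<phi> g) E)"
  unfolding group_action_def group_hom_def group_hom_axioms_def
proof (intro conjI)
  show "group (BijGroup E)" by (rule group_BijGroup)
  have "restrict (\<phi> g) E \<in> Bij E" if "g \<in> carrier G" for g
    using act_bij[OF that] by (auto simp: Bij_def bij_betw_restrict_eq)
  then show "(\<lambda>g. restrict (\<phi> g) E) \<in> hom G (BijGroup E)"
    by (auto simp: hom_def BijGroup_def fun_eq_iff compose_def act_mult act_closed)
qed (rule is_group)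

lemma orbit_stabilizer:
  assumes "x \<in> E"
  shows "card ((\<lambda>g. \<phi> g x) ` carrier G) * card {g \<in> carrier G. \<phi> g x = x} = order G"
proof -
  interpret A: group_action G E "\<lambda>g. restrict (\<phi> g) E"
    by (rule group_action_restrict)
  have "orbit G (\<lambda>g. restrict (\<phi> g) E) x = (\<lambda>g. \<phi> g x) ` carrier G"
    using assms by (auto simp: orbit_def)
  moreover have "stabilizer G (\<lambda>g. restrict (\<phi> g) E) x = {g \<in> carrier G. \<phi> g x = x}"
    using assms by (auto simp: stabilizer_def)
  ultimately show ?thesis
    using A.orbit_stabilizer_theorem[OF assms] by (simp add: mult.commute)
qed

lemma stabilizer_is_subgroup:
  assumes "x \<in> E"
  shows "subgroup {g \<in> carrier G. \<phi> g x = x} G"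
proof -
  interpret A: group_action G E "\<lambda>g. restrict (\<phi> g) E"
    by (rule group_action_restrict)
  have "stabilizer G (\<lambda>g. restrict (\<phi> g) E) x = {g \<in> carrier G. \<phi> g x = x}"
    using assms by (auto simp: stabilizer_def)
  then show ?thesis
    using A.stabilizer_subgroup[OF assms] by simp
qed

lemma restrict_to_subgroup:
  assumes "subgroup H G"
  shows "set_action (G\<lparr>carrier := H\<rparr>) E \<phi>"
proof -
  interpret H: group "G\<lparr>carrier := H\<rparr>"
    using assms by (rule subgroup_imp_group)
  show ?thesis
    by unfold_locales (use subgroup.mem_carrier[OF assms] in \<open>auto simp: act_closed act_mult act_one\<close>)
qed

lemma restrict_to_invariant:
  assumes "F \<subseteq> E" "\<And>g x. \<lbrakk>g \<in> carrier G; x \<in> F\<rbrakk> \<Longrightarrow> \<phi> g x \<in> F"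
  shows "set_action G F \<phi>"
  by unfold_locales (use assms in \<open>auto simp: act_mult act_one\<close>)

end

locale p_group_action = set_action +
  fixes p k :: nat
  assumes prime: "prime p" and order: "order G = p ^ k"
begin

lemma card_orbit:
  assumes "x \<in> E"
  obtains i where "card ((\<lambda>g. \<phi> g x) ` carrier G) = p ^ i"
proof -
  have "card ((\<lambda>g. \<phi> g x) ` carrier G) dvd p ^ k"
    using orbit_stabilizer[OF assms] order by (metis dvd_triv_left)
  then show ?thesis
    using that divides_primepow_nat[OF prime] by blast
qed

text \<open>Orbit sizes are powers of \<open>p\<close>, and the only such power below
  \<open>p\<close> is 1.\<close>

lemma fixed_if_small_orbit:
  assumes "x \<in> E" "(\<lambda>g. \<phi> g x) ` carrier G \<subseteq> F" "finite F" "card F < p" "g \<in> carrier G"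
  shows "\<phi> g x = x"
proof -
  obtain i where i: "card ((\<lambda>g. \<phi> g x) ` carrier G) = p ^ i"
    using card_orbit[OF assms(1)] .
  have "p ^ i < p"
    using card_mono[OF assms(3,2)] assms(4) i by simp
  then have "i = 0"
    using prime_gt_1_nat[OF prime] by (metis less_one linorder_not_less power_increasing power_one_right less_or_eq_imp_le)
  then obtain y where y: "(\<lambda>g. \<phi> g x) ` carrier G = {y}"
    using i by (auto simp: card_1_singleton_iff)
  have "\<phi> \<one> x \<in> {y}" "\<phi> g x \<in> {y}"
    unfolding y[symmetric] using assms(5) by (intro imageI; simp)+
  then show ?thesis using act_one[OF assms(1)] by simp
qed

end

text \<open>Orbits are removed one at a time; without fixed points each has size
  \<open>p ^ i\<close> with \<open>i > 0\<close>. The induction changes the set acted on, so the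
  action is a premise here and not a locale context.\<close>

lemma p_group_no_fixed_point:
  fixes G (structure)
  assumes "p_group_action G E \<phi> p k" "finite E"
    and "\<And>x. x \<in> E \<Longrightarrow> \<exists>g\<in>carrier G. \<phi> g x \<noteq> x"
  shows "p dvd card E"
  using assms
proof (induction "card E" arbitrary: E rule: less_induct)
  case less
  interpret p_group_action G E \<phi> p k by (rule less.prems)
  show ?case
  proof (cases "E = {}")
    case False
    then obtain x where x: "x \<in> E" by blast
    define O' where "O' = (\<lambda>g. \<phi> g x) ` carrier G"
    have sub: "O' \<subseteq> E" unfolding O'_def using x act_closed by auto
    have xO: "x \<in> O'" unfolding O'_def by (metis act_one image_eqI one_closed x)
    obtain i where i: "card O' = p ^ i" unfolding O'_def by (rule card_orbit[OF x])
    have "i \<noteq> 0"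
    proof
      assume "i = 0"
      then obtain y where y: "O' = {y}" using i by (auto simp: card_1_singleton_iff)
      have "\<phi> g x = x" if "g \<in> carrier G" for g
        using xO y that unfolding O'_def by (metis imageI singletonD)
      then show False using less.prems(3)[OF x] by blast
    qed
    then have pO: "p dvd card O'" using i by simp
    have inv': "\<phi> g y \<in> E - O'" if g: "g \<in> carrier G" and y: "y \<in> E - O'" for g y
    proof -
      have "\<phi> g y \<notin> O'"
      proof
        assume "\<phi> g y \<in> O'"
        then obtain h where h: "h \<in> carrier G" "\<phi> g y = \<phi> h x" unfolding O'_def by blast
        then have "y = \<phi> (inv g \<otimes> h) x"
          using act_inv(1)[of g y] act_mult[of "inv g" h x] g x y by simp
        then show False using y h g unfolding O'_def by blast
      qed
      then show ?thesis using act_closed g y by blast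
    qed
    have "set_action G (E - O') \<phi>"
      by (rule restrict_to_invariant) (use inv' in auto)
    then have pga: "p_group_action G (E - O') \<phi> p k"
      unfolding p_group_action_def p_group_action_axioms_def using prime order by simp
    have "card (E - O') < card E"
      using xO sub less.prems(2) by (intro psubset_card_mono) auto
    then have "p dvd card (E - O')"
      using less.hyps[OF _ pga] less.prems by blast
    moreover have "card E = card (E - O') + card O'"
      using sub less.prems(2) by (metis card_Diff_subset card_mono finite_subset le_add_diff_inverse2)
    ultimately show ?thesis using pO by simp
  qed simp
qed

context p_group_action
begin

lemma fixed_point_exists:
  assumes "finite E" "\<not> p dvd card E"
  obtains x where "x \<in> E" "\<And>g. g \<in> carrier G \<Longrightarrow> \<phi> g x = x"
  using p_group_no_fixed_point[OF p_group_action_axioms assms(1)] assms(2) by blast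

text \<open>Once \<open>x\<close> is removed, the number of remaining points is congruent to -1
  modulo \<open>p\<close>, so a fixed point is left among them.\<close>

lemma second_fixed_point:
  assumes "finite E" "p dvd card E" "x \<in> E" "\<And>g. g \<in> carrier G \<Longrightarrow> \<phi> g x = x"
  obtains y where "y \<in> E" "y \<noteq> x" "\<And>g. g \<in> carrier G \<Longrightarrow> \<phi> g y = y"
proof -
  have "\<phi> g y \<in> E - {x}" if "g \<in> carrier G" "y \<in> E - {x}" for g y
    using that act_bij[OF that(1)] assms(3) assms(4)[OF that(1)] act_closed
    by (auto simp: bij_betw_def inj_on_def)
  then have "set_action G (E - {x}) \<phi>"
    by (intro restrict_to_invariant) auto
  then interpret F: p_group_action G "E - {x}" \<phi> p k
    unfolding p_group_action_def p_group_action_axioms_def using prime order by simp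
  have "Suc (card (E - {x})) = card E"
    using assms(1,3) by (rule card_Suc_Diff1)
  then have "\<not> p dvd card (E - {x})"
    using assms(2) prime by (metis coprime_Suc_right_nat coprime_common_divisor not_prime_unit)
  then show thesis
    by (rule F.fixed_point_exists[OF finite_Diff[OF assms(1)]]) (use that in blast)
qed

text \<open>The orbit of \<open>x\<close> under the whole group has \<open>p\<close>-power size
  below \<open>p\<^sup>2\<close> and contains \<open>D\<close>, hence equals \<open>D\<close>. The
  stabiliser of \<open>x\<close> then acts on the fewer than \<open>p\<close> points of
  \<open>D - {x}\<close> and fixes them all, so on \<open>D\<close> an element is determined by its
  value at \<open>x\<close>, which some power of \<open>c\<close> also takes.\<close>

lemma acts_as_cycle:
  assumes "finite E" "card E < p\<^sup>2" "x \<in> E" "c \<in> carrier G"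
    and D: "D = (\<lambda>i. \<phi> (c [^] i) x) ` (UNIV :: nat set)" "card D = p"
    and g: "g \<in> carrier G"
  obtains i :: nat where "\<And>y. y \<in> D \<Longrightarrow> \<phi> g y = \<phi> (c [^] i) y"
proof -
  define O' where "O' = (\<lambda>g. \<phi> g x) ` carrier G"
  have DO: "D \<subseteq> O'" unfolding D O'_def using assms(4) by auto
  have OE: "O' \<subseteq> E" unfolding O'_def using act_closed assms(3) by auto
  then have finO: "finite O'" using assms(1) by (rule finite_subset)
  obtain j where j: "card O' = p ^ j" unfolding O'_def by (rule card_orbit[OF assms(3)])
  have "p ^ j < p ^ 2" using card_mono[OF assms(1) OE] assms(2) j by simp
  then have "j < 2" using prime_gt_1_nat[OF prime] by (simp add: power_strict_increasing_iff)
  then have "card O' \<le> p" using j prime_gt_0_nat[OF prime] by (cases j) (auto simp: less_Suc_eq)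
  then have DO': "D = O'" using DO finO D(2) by (metis card_seteq)
  have "\<phi> g x \<in> D" unfolding DO' O'_def using g by blast
  then obtain i :: nat where i: "\<phi> g x = \<phi> (c [^] i) x" unfolding D by blast
  \<comment> \<open>Dividing by the power of \<open>c\<close> that agrees with \<open>g\<close> at
    \<open>x\<close> leaves an element of the stabiliser of \<open>x\<close>.\<close>
  define w where "w = inv (c [^] i) \<otimes> g"
  have wc: "w \<in> carrier G" unfolding w_def using g assms(4) by simp
  have wx: "\<phi> w x = x"
    unfolding w_def using g assms(3,4) i act_mult[of "inv (c [^] i)" g x] act_inv(1)[of "c [^] i" x] by simp
  let ?U = "{g \<in> carrier G. \<phi> g x = x}"
  have U: "subgroup ?U G" by (rule stabilizer_is_subgroup[OF assms(3)])
  have "card ?U dvd p ^ k" using orbit_stabilizer[OF assms(3)] order by (metis dvd_triv_right)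
  then obtain m where m: "card ?U = p ^ m" using divides_primepow_nat[OF prime] by blast
  interpret U: set_action "G\<lparr>carrier := ?U\<rparr>" E \<phi> by (rule restrict_to_subgroup[OF U])
  interpret U: p_group_action "G\<lparr>carrier := ?U\<rparr>" E \<phi> p m
    by unfold_locales (use prime m in \<open>auto simp: order_def\<close>)
  have fixD: "\<phi> w y = y" if y: "y \<in> D" for y
  proof (cases "y = x")
    case False
    have yE: "y \<in> E" using y DO' OE by blast
    have "\<phi> u y \<in> D - {x}" if u: "u \<in> ?U" for u
    proof -
      have uc: "u \<in> carrier G" using u by blast
      obtain h where h: "h \<in> carrier G" "y = \<phi> h x" using y unfolding DO' O'_def by blast
      then have "\<phi> u y = \<phi> (u \<otimes> h) x" using act_mult[OF uc h(1) assms(3)] by simp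
      then have "\<phi> u y \<in> D" unfolding DO' O'_def using uc h(1) by blast
      moreover have "\<phi> u y \<noteq> x"
        using False u act_bij[OF uc] assms(3) yE by (auto simp: bij_betw_def inj_on_def)
      ultimately show ?thesis by blast
    qed
    then have "(\<lambda>g. \<phi> g y) ` carrier (G\<lparr>carrier := ?U\<rparr>) \<subseteq> D - {x}" by auto
    moreover have "x \<in> D" unfolding DO' O'_def by (metis act_one assms(3) image_eqI one_closed)
    then have "card (D - {x}) < p"
      using D(2) finO DO' by (metis card_Diff1_less)
    ultimately show ?thesis
      using U.fixed_if_small_orbit[OF yE, of "D - {x}" w] finO DO' wc wx by simp
  qed (use wx in simp)
  have "\<phi> g y = \<phi> (c [^] i) y" if y: "y \<in> D" for y
  proof -
    have yE: "y \<in> E" using y DO' OE by blast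
    have "g = c [^] i \<otimes> w" unfolding w_def using g assms(4) by (simp add: m_assoc[symmetric])
    then show ?thesis
      using act_mult[of "c [^] i" w y] assms(4) wc yE fixD[OF y] by simp
  qed
  then show thesis by (rule that)
qed

end

section \<open>Conjugation, coset actions and Sylow subgroups\<close>

context group
begin

lemma centralizer_subgroup:
  assumes c: "c \<in> carrier G"
  shows "subgroup {u \<in> carrier G. u \<otimes> c = c \<otimes> u} G"
proof (rule subgroupI)
  fix a assume a: "a \<in> {u \<in> carrier G. u \<otimes> c = c \<otimes> u}"
  then have "inv a \<otimes> c = c \<otimes> inv a"
    using c by (metis (mono_tags, lifting) inv_closed inv_solve_left inv_solve_right m_assoc m_closed mem_Collect_eq)
  then show "inv a \<in> {u \<in> carrier G. u \<otimes> c = c \<otimes> u}" using a by blast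
next
  fix a b
  assume "a \<in> {u \<in> carrier G. u \<otimes> c = c \<otimes> u}" "b \<in> {u \<in> carrier G. u \<otimes> c = c \<otimes> u}"
  then have ab: "a \<in> carrier G" "b \<in> carrier G" "a \<otimes> c = c \<otimes> a" "b \<otimes> c = c \<otimes> b" by blast+
  have "a \<otimes> b \<otimes> c = a \<otimes> c \<otimes> b" using ab(1,2) c by (simp add: m_assoc ab(4))
  also have "\<dots> = c \<otimes> (a \<otimes> b)" using ab(1,2) c by (simp add: m_assoc[symmetric] ab(3))
  finally show "a \<otimes> b \<in> {u \<in> carrier G. u \<otimes> c = c \<otimes> u}" using ab by blast
next
  show "{u \<in> carrier G. u \<otimes> c = c \<otimes> u} \<noteq> {}"
    using c by auto
qed blast

lemma conj_pow:
  assumes "g \<in> carrier G" "w \<in> carrier G"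
  shows "(g \<otimes> w \<otimes> inv g) [^] (n :: nat) = g \<otimes> w [^] n \<otimes> inv g"
proof (induction n)
  case (Suc n)
  have "inv g \<otimes> (g \<otimes> (w \<otimes> inv g)) = w \<otimes> inv g"
    using assms by (metis inv_closed l_inv l_one m_assoc m_closed)
  then show ?case using Suc assms by (simp add: m_assoc)
qed (use assms in simp)

lemma conj_eq_one:
  assumes "g \<in> carrier G" "w \<in> carrier G" "g \<otimes> w \<otimes> inv g = \<one>"
  shows "w = \<one>"
proof -
  have "inv (inv g) = g \<otimes> w"
    using assms by (intro inv_equality) auto
  then show ?thesis using assms(1,2) by simp
qed

text \<open>The inverse turns right multiplication on right cosets into a left action.\<close>

lemma coset_action:
  assumes "subgroup U G" "subgroup W G"
  shows "set_action (G\<lparr>carrier := U\<rparr>) (rcosets W) (\<lambda>u C. C #> inv u)"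
proof -
  interpret U: group "G\<lparr>carrier := U\<rparr>" using assms(1) by (rule subgroup_imp_group)
  note Uc = subgroup.mem_carrier[OF assms(1)] and Wc = subgroup.subset[OF assms(2)]
  have C: "C \<subseteq> carrier G" if "C \<in> rcosets W" for C
    using that Wc by (auto simp: RCOSETS_def dest: r_coset_subset_G)
  show ?thesis
  proof unfold_locales
    fix u C assume "u \<in> carrier (G\<lparr>carrier := U\<rparr>)" and C': "C \<in> rcosets W"
    then have u: "u \<in> carrier G" using Uc by simp
    obtain x where "x \<in> carrier G" "C = W #> x" using C' by (auto simp: RCOSETS_def)
    then show "C #> inv u \<in> rcosets W"
      using u Wc by (auto simp: coset_mult_assoc RCOSETS_def)
  next
    fix u w C
    assume "u \<in> carrier (G\<lparr>carrier := U\<rparr>)" "w \<in> carrier (G\<lparr>carrier := U\<rparr>)" "C \<in> rcosets W"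
    then show "C #> inv (u \<otimes>\<^bsub>G\<lparr>carrier := U\<rparr>\<^esub> w) = C #> inv w #> inv u"
      using Uc C by (simp add: coset_mult_assoc inv_mult_group)
  next
    fix C assume "C \<in> rcosets W"
    then show "C #> inv \<one>\<^bsub>G\<lparr>carrier := U\<rparr>\<^esub> = C"
      using C by simp
  qed
qed

lemma coset_fixed_imp_conj:
  assumes "subgroup W G" "x \<in> carrier G" "u \<in> carrier G" "(W #> x) #> inv u = W #> x"
  shows "x \<otimes> u \<otimes> inv x \<in> W"
proof -
  have "W #> (x \<otimes> inv u) = W #> x"
    using assms(2-4) subgroup.subset[OF assms(1)] by (simp add: coset_mult_assoc)
  then have "x \<otimes> inv u \<in> W #> x"
    using rcos_self[of "x \<otimes> inv u" W] assms by simp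
  then have "(x \<otimes> inv u) \<otimes> inv x \<in> W"
    using assms subgroup.rcos_module_imp[OF assms(1) is_group] by simp
  then have "inv ((x \<otimes> inv u) \<otimes> inv x) \<in> W"
    by (rule subgroup.m_inv_closed[OF assms(1)])
  then show ?thesis using assms by (simp add: inv_mult_group m_assoc)
qed

text \<open>The \<open>p\<close>-group \<open>U\<close> acts on the cosets of \<open>P\<close>,
  whose number is prime to \<open>p\<close>, and so fixes one of them. A fixed coset
  \<open>P #> x\<close> means that \<open>x\<close> conjugates \<open>U\<close> into
  \<open>P\<close>.\<close>

lemma p_subgroup_conj_into_sylow:
  assumes "finite (carrier G)" "prime p"
    and P: "subgroup P G" "\<not> p dvd card (rcosets P)"
    and U: "subgroup U G" "card U = p ^ b"
  obtains x where "x \<in> carrier G" "\<And>u. u \<in> U \<Longrightarrow> x \<otimes> u \<otimes> inv x \<in> P"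
proof -
  interpret A: set_action "G\<lparr>carrier := U\<rparr>" "rcosets P" "\<lambda>u C. C #> inv u"
    by (rule coset_action[OF U(1) P(1)])
  interpret A: p_group_action "G\<lparr>carrier := U\<rparr>" "rcosets P" "\<lambda>u C. C #> inv u" p b
    by unfold_locales (use assms in \<open>auto simp: order_def\<close>)
  have "finite (rcosets P)"
    using assms(1) by (auto simp: RCOSETS_def)
  then obtain C where C: "C \<in> rcosets P" "\<And>u. u \<in> U \<Longrightarrow> C #> inv u = C"
    by (rule A.fixed_point_exists[OF _ P(2)]) simp
  then obtain x where "x \<in> carrier G" "C = P #> x" by (auto simp: RCOSETS_def)
  then show thesis
    using that coset_fixed_imp_conj[OF P(1)] C(2) subgroup.mem_carrier[OF U(1)] by metis
qed

text \<open>Acting on its own cosets, whose number is divisible by \<open>p\<close>,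
  \<open>W\<close> fixes the coset \<open>W\<close> and hence a second coset \<open>W #> x\<close>.
  This \<open>x\<close> normalises \<open>W\<close> and lies outside it.\<close>

lemma normalizer_grows:
  assumes "order G = p ^ k" "prime p" "subgroup W G" "W \<noteq> carrier G"
  obtains x where "x \<in> carrier G" "x \<notin> W" "\<And>u. u \<in> W \<Longrightarrow> x \<otimes> u \<otimes> inv x \<in> W"
proof -
  have fin: "finite (carrier G)"
    using assms(1,2) by (metis order_gt_0_iff_finite prime_gt_0_nat zero_less_power)
  have lag: "card (rcosets W) * card W = p ^ k" using lagrange[OF assms(3)] assms(1) by simp
  then obtain b where b: "card W = p ^ b"
    using divides_primepow_nat[OF assms(2)] by (metis dvd_triv_right)
  obtain c where c: "card (rcosets W) = p ^ c"
    using lag divides_primepow_nat[OF assms(2)] by (metis dvd_triv_left)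
  have "c \<noteq> 0"
  proof
    assume "c = 0"
    then have "card W = card (carrier G)" using lag c assms(1) by (simp add: order_def)
    then show False
      using assms(4) fin subgroup.subset[OF assms(3)] by (metis card_subset_eq)
  qed
  then have pd: "p dvd card (rcosets W)" using c by simp
  interpret A: set_action "G\<lparr>carrier := W\<rparr>" "rcosets W" "\<lambda>u C. C #> inv u"
    by (rule coset_action[OF assms(3,3)])
  interpret A: p_group_action "G\<lparr>carrier := W\<rparr>" "rcosets W" "\<lambda>u C. C #> inv u" p b
    by unfold_locales (use assms b in \<open>auto simp: order_def\<close>)
  have finr: "finite (rcosets W)"
    using fin by (auto simp: RCOSETS_def)
  have W: "W \<in> rcosets W" using subgroup.subgroup_in_rcosets[OF assms(3) is_group] .
  have "W #> inv u = W" if "u \<in> carrier (G\<lparr>carrier := W\<rparr>)" for u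
    using that assms(3) coset_join2[of "inv u" W] subgroup.mem_carrier subgroup.m_inv_closed by fastforce
  then obtain C where C: "C \<in> rcosets W" "C \<noteq> W" "\<And>u. u \<in> W \<Longrightarrow> C #> inv u = C"
    by (rule A.second_fixed_point[OF finr pd W]) simp_all
  then obtain x where x: "x \<in> carrier G" "C = W #> x" by (auto simp: RCOSETS_def)
  then have "x \<notin> W" using C(2) coset_join2 assms(3) by blast
  then show thesis
    using that x coset_fixed_imp_conj[OF assms(3)] C(3) subgroup.mem_carrier[OF assms(3)] by metis
qed

text \<open>Under conjugation the neutral element is a fixed point of a set of size divisible by
  \<open>p\<close>; any second fixed point is central.\<close>

lemma p_group_center_nontrivial:
  assumes "order G = p ^ k" "prime p" "k > 0"
  obtains z where "z \<in> carrier G" "z \<noteq> \<one>" "\<And>g. g \<in> carrier G \<Longrightarrow> g \<otimes> z = z \<otimes> g"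
proof -
  have fin: "finite (carrier G)"
    using assms(1,2) by (metis order_gt_0_iff_finite prime_gt_0_nat zero_less_power)
  interpret p_group_action G "carrier G" "\<lambda>g x. g \<otimes> x \<otimes> inv g" p k
    by unfold_locales (use assms in \<open>auto simp: m_assoc inv_mult_group\<close>)
  have "p dvd card (carrier G)" using assms by (simp add: order_def)
  then obtain z where z: "z \<in> carrier G" "z \<noteq> \<one>" "\<And>g. g \<in> carrier G \<Longrightarrow> g \<otimes> z \<otimes> inv g = z"
    using second_fixed_point[OF fin, of \<one>] by auto
  then have "g \<otimes> z = z \<otimes> g" if "g \<in> carrier G" for g
    using that by (metis inv_solve_right' m_closed)
  then show thesis using that z by blast
qed

text \<open>Some Sylow \<open>p\<close>-subgroup absorbs every element of \<open>p\<close>-power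
  order up to conjugation; conjugating it back makes it contain \<open>c\<close> itself.\<close>

lemma sylow_containing:
  assumes "finite (carrier G)" "prime p" and c: "c \<in> carrier G" "c [^] (p ^ i) = \<one>"
  obtains P k where "subgroup P G" "card P = p ^ k" "c \<in> P"
    "\<And>u j. \<lbrakk>u \<in> carrier G; u [^] (p ^ j :: nat) = \<one>\<rbrakk> \<Longrightarrow> \<exists>x\<in>carrier G. x \<otimes> u \<otimes> inv x \<in> P"
proof -
  define a where "a = multiplicity p (order G)"
  have pos: "order G > 0" using assms(1) order_gt_0_iff_finite by blast
  then obtain m where m: "order G = p ^ a * m" "\<not> p dvd m"
    unfolding a_def using assms(2) multiplicity_decompose'[of "order G" p] by (metis bot_nat_0.not_eq_extremum not_prime_unit)
  obtain P where P: "subgroup P G" "card P = p ^ a"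
    using sylow_thm[OF assms(2) is_group m(1) assms(1)] by blast
  have "card (rcosets P) = m"
    using lagrange[OF P(1)] P(2) m(1) assms(2) by (simp add: mult.commute prime_gt_0_nat)
  then have np: "\<not> p dvd card (rcosets P)" using m(2) by simp
  have conj: "\<exists>x\<in>carrier G. x \<otimes> u \<otimes> inv x \<in> P"
    if u: "u \<in> carrier G" "u [^] (p ^ j :: nat) = \<one>" for u j
  proof -
    have "card (generate G {u}) dvd p ^ j"
      using u pow_eq_id generate_pow_card by metis
    then obtain b where "card (generate G {u}) = p ^ b"
      using divides_primepow_nat[OF assms(2)] by blast
    moreover have "subgroup (generate G {u}) G" using u by (simp add: generate_is_subgroup)
    moreover have "u \<in> generate G {u}" by (simp add: generate.incl)
    ultimately show ?thesis
      using p_subgroup_conj_into_sylow[OF assms(1,2) P(1) np] by metis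
  qed
  obtain y where y: "y \<in> carrier G" "y \<otimes> c \<otimes> inv y \<in> P" using conj[OF c] by blast
  \<comment> \<open>This is the conjugate of \<open>P\<close> by the inverse of \<open>y\<close>; it
    contains \<open>c\<close> by the choice of \<open>y\<close>.\<close>
  define P' where "P' = {x \<in> carrier G. y \<otimes> x \<otimes> inv y \<in> P}"
  have P'_eq: "P' = (\<lambda>x. inv y \<otimes> x \<otimes> y) ` P"
  proof (intro equalityI subsetI)
    fix x assume "x \<in> P'"
    then have "x \<in> carrier G" "y \<otimes> x \<otimes> inv y \<in> P" unfolding P'_def by auto
    moreover from this have "x = inv y \<otimes> (y \<otimes> x \<otimes> inv y) \<otimes> y"
      using y(1) by (simp add: m_assoc inv_solve_left)
    ultimately show "x \<in> (\<lambda>x. inv y \<otimes> x \<otimes> y) ` P" by blast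
  next
    fix x assume "x \<in> (\<lambda>x. inv y \<otimes> x \<otimes> y) ` P"
    then obtain z where z: "z \<in> P" "x = inv y \<otimes> z \<otimes> y" by blast
    then have zc: "z \<in> carrier G" using subgroup.mem_carrier[OF P(1)] by blast
    then have "y \<otimes> x \<otimes> inv y = z"
      unfolding z(2) using y(1) by (metis inv_closed inv_solve_left' inv_solve_right m_assoc m_closed)
    then show "x \<in> P'" unfolding P'_def using z zc y(1) by simp
  qed
  have "inj_on (\<lambda>x. inv y \<otimes> x \<otimes> y) P"
    by (rule inj_onI) (use y(1) subgroup.mem_carrier[OF P(1)] in \<open>simp\<close>)
  then have card: "card P' = p ^ a" unfolding P'_eq using P(2) by (simp add: card_image)
  have mult: "y \<otimes> (x \<otimes> z) \<otimes> inv y = (y \<otimes> x \<otimes> inv y) \<otimes> (y \<otimes> z \<otimes> inv y)"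
    if "x \<in> carrier G" "z \<in> carrier G" for x z
    using that y(1) by (metis inv_closed inv_solve_right' m_assoc m_closed)
  have sub: "subgroup P' G"
  proof (rule subgroupI)
    show "P' \<subseteq> carrier G" unfolding P'_def by blast
    show "P' \<noteq> {}" unfolding P'_eq using subgroup.one_closed[OF P(1)] by blast
  next
    fix x assume "x \<in> P'"
    then have x: "x \<in> carrier G" "y \<otimes> x \<otimes> inv y \<in> P" unfolding P'_def by auto
    have "inv (y \<otimes> x \<otimes> inv y) = y \<otimes> inv x \<otimes> inv y"
      using x y(1) by (simp add: inv_mult_group m_assoc)
    then show "inv x \<in> P'"
      unfolding P'_def using x subgroup.m_inv_closed[OF P(1) x(2)] by simp
  next
    fix x z assume "x \<in> P'" "z \<in> P'"
    then show "x \<otimes> z \<in> P'"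
      unfolding P'_def using mult subgroup.m_closed[OF P(1)] by auto
  qed
  have "\<exists>x\<in>carrier G. x \<otimes> u \<otimes> inv x \<in> P'"
    if u: "u \<in> carrier G" "u [^] (p ^ j :: nat) = \<one>" for u j
  proof -
    obtain x where x: "x \<in> carrier G" "x \<otimes> u \<otimes> inv x \<in> P" using conj[OF u] by blast
    have "inv y \<otimes> (x \<otimes> u \<otimes> inv x) \<otimes> y = (inv y \<otimes> x) \<otimes> u \<otimes> inv (inv y \<otimes> x)"
      using x(1) y(1) u(1) by (simp add: inv_mult_group m_assoc)
    then show ?thesis unfolding P'_eq using x y(1)
      by (intro bexI[of _ "inv y \<otimes> x"]) (auto intro!: image_eqI[of _ _ "x \<otimes> u \<otimes> inv x"])
  qed
  then show thesis using that[OF sub card] c y unfolding P'_def by blast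
qed

end

section \<open>The automorphism group of a Sidon configuration\<close>

text \<open>
  Permutations of \<open>\<int>\<^sub>v\<close> are represented by \<open>v\<close>-periodic functions on the integers
  with values in \<open>{0..<v}\<close>, so the identity is \<open>\<lambda>x. x mod v\<close>. Line \<open>y\<close> is
  the translate \<open>S + y\<close> of a \<open>v\<close>-periodic set \<open>S\<close>, so point \<open>x\<close> lies on
  it iff \<open>x - y \<in> S\<close>; an isomorphism is a pair of a point map and a line map.
\<close>

definition zperm :: "int \<Rightarrow> (int \<Rightarrow> int) set" where
  "zperm v = {g. (\<forall>x. g x \<in> {0..<v}) \<and> (\<forall>x y. g x = g y \<longleftrightarrow> [x = y] (mod v))}"

definition inc_iso :: "int \<Rightarrow> int set \<Rightarrow> int set \<Rightarrow> ((int \<Rightarrow> int) \<times> (int \<Rightarrow> int)) set" where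
  "inc_iso v S T = {(g, l). g \<in> zperm v \<and> l \<in> zperm v \<and> (\<forall>x y. x - y \<in> S \<longleftrightarrow> g x - l y \<in> T)}"

definition aut_group :: "int \<Rightarrow> int set \<Rightarrow> ((int \<Rightarrow> int) \<times> (int \<Rightarrow> int)) monoid" where
  "aut_group v S = \<lparr>carrier = inc_iso v S S,
     monoid.mult = (\<lambda>a b. (fst a \<circ> fst b, snd a \<circ> snd b)),
     one = ((\<lambda>x. x mod v), (\<lambda>x. x mod v))\<rparr>"

definition transl :: "int \<Rightarrow> int \<Rightarrow> (int \<Rightarrow> int) \<times> (int \<Rightarrow> int)" where
  "transl v t = ((\<lambda>x. (x + t) mod v), (\<lambda>x. (x + t) mod v))"

section \<open>Periodic permutations and incidence isomorphisms\<close>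

lemma zperm_range: "g \<in> zperm v \<Longrightarrow> g x \<in> {0..<v}"
  by (simp add: zperm_def)

lemma zperm_mod [simp]: "g \<in> zperm v \<Longrightarrow> g x mod v = g x"
  using zperm_range[of g v x] by simp

lemma zperm_eq_iff: "g \<in> zperm v \<Longrightarrow> g x = g y \<longleftrightarrow> [x = y] (mod v)"
  by (simp add: zperm_def)

lemma zperm_cong_iff: "g \<in> zperm v \<Longrightarrow> [g x = g y] (mod v) \<longleftrightarrow> [x = y] (mod v)"
  using zperm_eq_iff[of g v x y] by (simp add: cong_def)

lemma zperm_arg_mod [simp]: "g \<in> zperm v \<Longrightarrow> g (x mod v) = g x"
  by (simp add: zperm_eq_iff cong_def)

lemma zperm_bij:
  assumes "g \<in> zperm v"
  shows "bij_betw g {0..<v} {0..<v}"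
proof -
  have "inj_on g {0..<v}"
    using assms by (auto intro!: inj_onI simp: zperm_eq_iff cong_def)
  moreover have "g ` {0..<v} \<subseteq> {0..<v}"
    using zperm_range[OF assms] by blast
  ultimately show ?thesis
    by (simp add: bij_betw_def endo_inj_surj)
qed

lemma zperm_surj:
  assumes "g \<in> zperm v" "v > 0"
  obtains y where "g y = x mod v"
proof -
  have "x mod v \<in> g ` {0..<v}"
    using zperm_bij[OF assms(1)] assms(2) by (auto simp: bij_betw_def)
  then show ?thesis using that by auto
qed

lemma zperm_inverse:
  assumes "g \<in> zperm v" "v > 0"
  obtains h where "h \<in> zperm v" "\<And>x. h (g x) = x mod v" "\<And>x. g (h x) = x mod v"
proof -
  \<comment> \<open>The chosen preimage depends on \<open>x\<close> only through
    \<open>x mod v\<close>, which makes \<open>h\<close> periodic.\<close>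
  define h where "h x = (SOME y. y \<in> {0..<v} \<and> g y = x mod v)" for x
  have h: "h x \<in> {0..<v} \<and> g (h x) = x mod v" for x
  proof -
    obtain y where "g y = x mod v" by (rule zperm_surj[OF assms])
    then have "\<exists>y. y \<in> {0..<v} \<and> g y = x mod v"
      using assms by (intro exI[of _ "y mod v"]) auto
    then show ?thesis unfolding h_def by (rule someI_ex)
  qed
  have hg: "h (g x) = x mod v" for x
  proof -
    have "g (h (g x)) = g x" using h[of "g x"] assms by simp
    then have "[h (g x) = x] (mod v)" using assms zperm_eq_iff by blast
    then show ?thesis using h[of "g x"] by (simp add: cong_def)
  qed
  have "h x = h y \<longleftrightarrow> [x = y] (mod v)" for x y
  proof
    assume "h x = h y"
    then show "[x = y] (mod v)" using h by (metis cong_def)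
  next
    assume "[x = y] (mod v)"
    then show "h x = h y" by (simp add: h_def cong_def)
  qed
  then have "h \<in> zperm v" using h by (simp add: zperm_def)
  then show thesis using that hg h by blast
qed

lemma shift_zperm: "v > 0 \<Longrightarrow> (\<lambda>x. (x + t) mod v) \<in> zperm v"
  by (simp add: zperm_def cong_def[symmetric] cong_add_rcancel)

lemma comp_zperm: "g \<in> zperm v \<Longrightarrow> h \<in> zperm v \<Longrightarrow> g \<circ> h \<in> zperm v"
  by (simp add: zperm_def) (metis cong_def mod_pos_pos_trivial)

lemma finite_zperm: "finite (zperm v)"
proof (rule finite_subset)
  show "zperm v \<subseteq> (\<lambda>h x. h (x mod v)) ` ({0..<v} \<rightarrow>\<^sub>E {0..<v})"
  proof
    fix g assume g: "g \<in> zperm v"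
    then have v: "v > 0" using zperm_range[OF g, of 0] by simp
    have "g = (\<lambda>x. restrict g {0..<v} (x mod v))"
      using g v by (auto simp: fun_eq_iff)
    moreover have "restrict g {0..<v} \<in> {0..<v} \<rightarrow>\<^sub>E {0..<v}"
      using zperm_range[OF g] by auto
    ultimately show "g \<in> (\<lambda>h x. h (x mod v)) ` ({0..<v} \<rightarrow>\<^sub>E {0..<v})" by blast
  qed
qed (simp add: finite_PiE)

lemma inc_isoI:
  "\<lbrakk>g \<in> zperm v; l \<in> zperm v; \<And>x y. x - y \<in> S \<longleftrightarrow> g x - l y \<in> T\<rbrakk> \<Longrightarrow> (g, l) \<in> inc_iso v S T"
  by (simp add: inc_iso_def)

lemma inc_isoD:
  assumes "u \<in> inc_iso v S T"
  shows "fst u \<in> zperm v" "snd u \<in> zperm v" "x - y \<in> S \<longleftrightarrow> fst u x - snd u y \<in> T"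
  using assms by (auto simp: inc_iso_def)

lemma inc_iso_comp:
  assumes "u \<in> inc_iso v S T" "w \<in> inc_iso v T R"
  shows "(fst w \<circ> fst u, snd w \<circ> snd u) \<in> inc_iso v S R"
  using assms by (intro inc_isoI) (auto simp: inc_isoD comp_zperm inc_isoD(3)[of u] inc_isoD(3)[of w])

lemma carrier_aut_group: "carrier (aut_group v S) = inc_iso v S S"
  by (simp add: aut_group_def)

lemma aut_group_sel [simp]:
  "fst (a \<otimes>\<^bsub>aut_group v S\<^esub> b) = fst a \<circ> fst b"
  "snd (a \<otimes>\<^bsub>aut_group v S\<^esub> b) = snd a \<circ> snd b"
  "fst \<one>\<^bsub>aut_group v S\<^esub> = (\<lambda>x. x mod v)" "snd \<one>\<^bsub>aut_group v S\<^esub> = (\<lambda>x. x mod v)"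
  by (simp_all add: aut_group_def)

lemma fst_transl [simp]: "fst (transl v t) x = (x + t) mod v"
  and snd_transl [simp]: "snd (transl v t) x = (x + t) mod v"
  by (simp_all add: transl_def)

definition periodic_set :: "int \<Rightarrow> int set \<Rightarrow> bool" where
  "periodic_set v S \<longleftrightarrow> (\<forall>s t. [s = t] (mod v) \<longrightarrow> s \<in> S \<longrightarrow> t \<in> S)"

lemma periodic_setD: "\<lbrakk>periodic_set v S; [s = t] (mod v)\<rbrakk> \<Longrightarrow> s \<in> S \<longleftrightarrow> t \<in> S"
  unfolding periodic_set_def by (meson cong_sym)

lemma periodic_set_mod_diff:
  "periodic_set v S \<Longrightarrow> x mod v - y mod v \<in> S \<longleftrightarrow> x - y \<in> S"
  by (erule periodic_setD) (unfold cong_def, rule mod_diff_eq)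

lemma inc_iso_inverse:
  assumes "u \<in> inc_iso v S T" "v > 0" and T: "periodic_set v T"
  obtains w where "w \<in> inc_iso v T S"
    "\<And>x. fst w (fst u x) = x mod v" "\<And>x. fst u (fst w x) = x mod v"
    "\<And>x. snd w (snd u x) = x mod v" "\<And>x. snd u (snd w x) = x mod v"
proof -
  note u = inc_isoD[OF assms(1)]
  obtain g where g: "g \<in> zperm v" "\<And>x. g (fst u x) = x mod v" "\<And>x. fst u (g x) = x mod v"
    using zperm_inverse[OF u(1) assms(2)] by blast
  obtain l where l: "l \<in> zperm v" "\<And>x. l (snd u x) = x mod v" "\<And>x. snd u (l x) = x mod v"
    using zperm_inverse[OF u(2) assms(2)] by blast
  have "(g, l) \<in> inc_iso v T S"
    using g l u(3) by (intro inc_isoI) (simp_all add: periodic_set_mod_diff[OF T])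
  then show thesis using that[of "(g, l)"] g l by simp
qed

text \<open>With \<open>t = e\<close> this applies to maps commuting with a translation, with
  \<open>e = 1\<close> or \<open>t = 1\<close> to maps normalising the group of
  translations.\<close>

lemma shift_multiple:
  fixes f :: "int \<Rightarrow> int"
  assumes "\<And>x. [f (x + e) = f x + t] (mod v)"
  shows "[f (x + e * m) = f x + t * m] (mod v)"
proof -
  have shift_nat: "[f (x + e * int m) = f x + t * int m] (mod v)" for x m
  proof (induction m)
    case (Suc m)
    have "[f (x + e * int m + e) = f (x + e * int m) + t] (mod v)" by (rule assms)
    also have "[f (x + e * int m) + t = f x + t * int m + t] (mod v)"
      using Suc by (intro cong_add) auto
    finally show ?case by (simp add: algebra_simps)
  qed simp
  show ?thesis
  proof (cases "m \<ge> 0")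
    case True
    then show ?thesis using shift_nat[of x "nat m"] by simp
  next
    case False
    then have "[f x = f (x + e * m) - t * m] (mod v)"
      using shift_nat[of "x + e * m" "nat (- m)"] by simp
    then have "[f x + t * m = f (x + e * m) - t * m + t * m] (mod v)"
      by (intro cong_add) auto
    then show ?thesis by (simp add: cong_sym)
  qed
qed

text \<open>Since the points \<open>x\<close> and \<open>x + (s - t)\<close> lie on the common line
  \<open>x - t\<close>, the connected components of the configuration are the residue classes modulo
  this number. The value 1 means that the configuration is connected.\<close>

definition diff_gcd :: "int set \<Rightarrow> int" where
  "diff_gcd S = Gcd {s - t | s t. s \<in> S \<and> t \<in> S}"

lemma diff_gcd_dvd: "s \<in> S \<Longrightarrow> t \<in> S \<Longrightarrow> diff_gcd S dvd s - t"
  unfolding diff_gcd_def by (rule Gcd_dvd) blast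

text \<open>The periods of \<open>\<delta>\<close> form a group of integers; containing all
  differences of \<open>S\<close>, it contains the multiples of their gcd.\<close>

lemma period_diff_gcd:
  fixes \<delta> :: "int \<Rightarrow> 'b"
  assumes "\<And>x s t. s \<in> S \<Longrightarrow> t \<in> S \<Longrightarrow> \<delta> (x + (s - t)) = \<delta> x" and xy: "[x = y] (mod diff_gcd S)"
  shows "\<delta> x = \<delta> y"
proof -
  let ?D = "{s - t | s t. s \<in> S \<and> t \<in> S}"
  have per: "\<delta> (z + d) = \<delta> z" if "d \<in> group_closure ?D" for d z
    using that
  proof (induction arbitrary: z rule: group_closure.induct)
    case (base s)
    then show ?case using assms by auto
  next
    case (diff s t)
    show ?case using diff.IH(1)[of "z - t"] diff.IH(2)[of "z - t"] by (simp add: algebra_simps)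
  qed
  have "x - y \<in> group_closure ?D"
    using xy unfolding group_closure_eq diff_gcd_def cong_iff_dvd_diff by (auto elim: dvdE)
  then show ?thesis using per[of "x - y" y] by simp
qed

text \<open>The property \<open>sidon\<close> expresses that distinct translates of \<open>S\<close>
  share at most one residue: if \<open>a - b\<close> and \<open>c - d\<close> agree, then
  \<open>a\<close> and \<open>b\<close> both lie in \<open>S\<close> and in its translate by
  \<open>a - c\<close>.\<close>

locale sidon_set =
  fixes v :: int and S :: "int set"
  assumes v_pos: "v > 0"
    and periodic: "periodic_set v S"
    and sidon: "\<lbrakk>a \<in> S; b \<in> S; c \<in> S; d \<in> S; [a - b = c - d] (mod v)\<rbrakk>
      \<Longrightarrow> [a = b] (mod v) \<or> [a = c] (mod v)"
    and card_ge_3: "card (S \<inter> {0..<v}) \<ge> 3"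
begin

abbreviation A where "A \<equiv> aut_group v S"

lemma transl_closed [simp]: "transl v t \<in> carrier A"
  unfolding transl_def carrier_aut_group
  by (intro inc_isoI shift_zperm v_pos) (simp add: periodic_set_mod_diff[OF periodic])

lemma group_A: "group A"
proof (rule groupI)
  fix a b assume "a \<in> carrier A" "b \<in> carrier A"
  then have "(fst a \<circ> fst b, snd a \<circ> snd b) \<in> inc_iso v S S" by (simp add: inc_iso_comp carrier_aut_group)
  then show "a \<otimes>\<^bsub>A\<^esub> b \<in> carrier A" by (simp add: aut_group_def)
next
  show "\<one>\<^bsub>A\<^esub> \<in> carrier A" using transl_closed[of 0] by (simp add: transl_def aut_group_def)
next
  fix a assume a: "a \<in> carrier A"
  then show "\<one>\<^bsub>A\<^esub> \<otimes>\<^bsub>A\<^esub> a = a"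
    by (simp add: prod_eq_iff fun_eq_iff inc_isoD carrier_aut_group)
  obtain w where "w \<in> inc_iso v S S" "\<And>x. fst w (fst a x) = x mod v" "\<And>x. snd w (snd a x) = x mod v"
    using inc_iso_inverse[of a v S S] a v_pos periodic by (metis carrier_aut_group)
  then show "\<exists>y\<in>carrier A. y \<otimes>\<^bsub>A\<^esub> a = \<one>\<^bsub>A\<^esub>"
    by (auto simp: prod_eq_iff fun_eq_iff carrier_aut_group intro!: bexI[of _ w])
qed (simp add: prod_eq_iff comp_assoc)

sublocale group A by (rule group_A)

lemma fin_A: "finite (carrier A)"
  by (rule finite_subset[of _ "zperm v \<times> zperm v"]) (auto simp: inc_iso_def finite_zperm carrier_aut_group)

lemma transl_mult: "transl v s \<otimes>\<^bsub>A\<^esub> transl v t = transl v (s + t)"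
  by (simp add: prod_eq_iff fun_eq_iff mod_simps ac_simps)

lemma transl_zero: "\<one>\<^bsub>A\<^esub> = transl v 0"
  by (simp add: prod_eq_iff fun_eq_iff)

lemma transl_eq_iff: "transl v s = transl v t \<longleftrightarrow> [s = t] (mod v)"
proof
  assume "transl v s = transl v t"
  then have "fst (transl v s) 0 = fst (transl v t) 0" by simp
  then show "[s = t] (mod v)" by (simp add: cong_def)
qed (auto simp: prod_eq_iff fun_eq_iff cong_def[symmetric] intro: cong_add)

lemma transl_eq_one_iff: "transl v t = \<one>\<^bsub>A\<^esub> \<longleftrightarrow> v dvd t"
  by (simp add: transl_zero transl_eq_iff cong_0_iff)

lemma transl_inv: "inv\<^bsub>A\<^esub> (transl v t) = transl v (- t)"
  by (rule inv_equality) (simp_all add: transl_mult transl_zero)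

lemma transl_pow: "transl v t [^]\<^bsub>A\<^esub> (n :: nat) = transl v (int n * t)"
  by (induction n) (simp_all add: transl_mult transl_zero algebra_simps)

lemma A_zperm:
  assumes "u \<in> carrier A"
  shows "fst u \<in> zperm v" "snd u \<in> zperm v"
  using assms inc_isoD by (auto simp: carrier_aut_group)

lemma A_inc: "u \<in> carrier A \<Longrightarrow> fst u x - snd u y \<in> S \<longleftrightarrow> x - y \<in> S"
  using inc_isoD(3)[of u v S S x y] by (simp add: carrier_aut_group)

lemma base_points:
  obtains a b where "a \<in> S" "b \<in> S" "\<not> [a = b] (mod v)"
proof -
  obtain a b where "a \<in> S \<inter> {0..<v}" "b \<in> S \<inter> {0..<v}" "a \<noteq> b"
    using card_ge_3 card_le_Suc0_iff_eq[of "S \<inter> {0..<v}"] by fastforce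
  then show ?thesis using that by (auto simp: cong_def)
qed

text \<open>Otherwise the difference \<open>t\<close> would arise at two incongruent elements of
  \<open>S\<close>.\<close>

lemma translation_stabilizer_trivial:
  assumes "\<And>s. s \<in> S \<Longrightarrow> s + t \<in> S"
  shows "v dvd t"
proof -
  obtain a b where ab: "a \<in> S" "b \<in> S" "\<not> [a = b] (mod v)" by (rule base_points)
  have "[a + t = a] (mod v) \<or> [a + t = b + t] (mod v)"
    using sidon[of "a + t" a "b + t" b] ab assms by simp
  then show ?thesis
    using ab(3) by (auto simp: cong_add_rcancel cong_add_lcancel_0 cong_0_iff)
qed

text \<open>The point map determines the line map: the two images of line \<open>y\<close> carry the
  same points, so their difference translates \<open>S\<close> into itself and vanishes.\<close>

lemma A_eqI:
  assumes u: "u \<in> carrier A" and w: "w \<in> carrier A" and eq: "fst u = fst w"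
  shows "u = w"
proof -
  have "snd u y = snd w y" for y
  proof -
    have "v dvd snd u y - snd w y"
    proof (rule translation_stabilizer_trivial)
      fix s assume s: "s \<in> S"
      obtain x where x: "fst u x = (s + snd u y) mod v"
        by (rule zperm_surj[OF A_zperm(1)[OF u] v_pos])
      have "[fst u x - snd u y = s] (mod v)"
        unfolding x by (simp add: cong_def mod_diff_left_eq)
      then have "x - y \<in> S"
        using s periodic_setD[OF periodic] A_inc[OF u] by blast
      then have "fst w x - snd w y \<in> S" using A_inc[OF w] by blast
      moreover have "[fst w x - snd w y = s + (snd u y - snd w y)] (mod v)"
        unfolding eq[symmetric] x by (simp add: cong_def mod_diff_left_eq algebra_simps)
      ultimately show "s + (snd u y - snd w y) \<in> S"
        using periodic_setD[OF periodic] by blast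
    qed
    then have "[snd u y = snd w y] (mod v)" by (simp add: cong_iff_dvd_diff)
    then show ?thesis using A_zperm(2)[OF u] A_zperm(2)[OF w] by (simp add: cong_def)
  qed
  then show ?thesis using eq by (simp add: prod_eq_iff fun_eq_iff)
qed

lemma transl_if_fst:
  assumes "u \<in> carrier A" "\<And>x. [fst u x = x + t] (mod v)"
  shows "u = transl v t"
proof (rule A_eqI)
  show "fst u = fst (transl v t)"
    using assms A_zperm(1)[OF assms(1)] by (simp add: fun_eq_iff cong_def)
qed (use assms in auto)

end

locale connected_sidon_set = sidon_set +
  assumes connected: "diff_gcd S = 1"
begin

text \<open>The Sidon property forces a line and every point on it to be displaced by the same
  amount. The displacement is then constant along lines, and by connectedness it is constant
  everywhere.\<close>

lemma block_translation_is_transl: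
  assumes u: "u \<in> carrier A"
    and p: "\<And>x. [fst u x = x] (mod e)" and l: "\<And>y. [snd u y = y] (mod e)"
    and e: "\<And>x. [fst u (x + e) = fst u x + e] (mod v)"
  obtains t where "u = transl v t"
proof -
  have shift: "[fst u (x + e * m) = fst u x + e * m] (mod v)" for x m
    using e by (rule shift_multiple)
  have key: "[fst u (y + s) - (y + s) = snd u y - y] (mod v)" if s: "s \<in> S" for y s
  proof -
    define s' where "s' = fst u (y + s) - snd u y"
    define s'' where "s'' = fst u (y + s') - snd u y"
    have s': "s' \<in> S" unfolding s'_def using s A_inc[OF u] by simp
    then have s'': "s'' \<in> S" unfolding s''_def using A_inc[OF u] by simp
    have "e dvd (fst u (y + s) - (y + s)) - (snd u y - y)"
      using p[of "y + s"] l[of y] unfolding cong_iff_dvd_diff by (rule dvd_diff)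
    then obtain m where "(fst u (y + s) - (y + s)) - (snd u y - y) = e * m" by (rule dvdE)
    then have m: "s' = s + e * m" unfolding s'_def by simp
    \<comment> \<open>\<open>u\<close> moves \<open>s\<close> and \<open>s'\<close> by the same amount, so \<open>s, s', s''\<close> is an arithmetic progression in \<open>S\<close>.\<close>
    have "[s'' - s' = s' - s] (mod v)"
    proof -
      have "[fst u (y + s + e * m) = fst u (y + s) + e * m] (mod v)" by (rule shift)
      then have "[fst u (y + s') = fst u (y + s) + e * m] (mod v)" by (simp add: m add.assoc)
      then show ?thesis
        unfolding cong_iff_dvd_diff s''_def using m by (simp add: s'_def algebra_simps)
    qed
    note eq = this
    \<comment> \<open>The progression has \<open>s'\<close> as its middle term, so both alternatives
      offered by \<open>sidon\<close> coincide.\<close>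
    then have "[s'' = s'] (mod v)"
      using sidon[OF s'' s' s' s] by blast
    then have "v dvd (s'' - s') - ((s'' - s') - (s' - s))"
      using eq unfolding cong_iff_dvd_diff by (rule dvd_diff)
    then show ?thesis unfolding s'_def by (simp add: cong_iff_dvd_diff algebra_simps)
  qed
  have const: "(fst u x - x) mod v = (fst u y - y) mod v" for x y
  proof (rule period_diff_gcd[where \<delta> = "\<lambda>x. (fst u x - x) mod v" and S = S])
    show "[x = y] (mod diff_gcd S)" by (simp add: connected)
  next
    fix x s t assume "s \<in> S" "t \<in> S"
    then show "(fst u (x + (s - t)) - (x + (s - t))) mod v = (fst u x - x) mod v"
      \<comment> \<open>Both points are compared with the line \<open>x - t\<close>, which contains
        them.\<close>
      using key[of s "x - t"] key[of t "x - t"] by (simp add: cong_def algebra_simps)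
  qed
  have "u = transl v (fst u 0)"
  proof (rule transl_if_fst[OF u])
    fix x
    have "[fst u x - x = fst u 0 - 0] (mod v)" using const[of x 0] by (simp add: cong_def)
    then show "[fst u x = x + fst u 0] (mod v)" by (simp add: cong_iff_dvd_diff algebra_simps)
  qed
  then show thesis by (rule that)
qed

end

section \<open>Products of two primes\<close>

text \<open>The second premise says that \<open>c\<close> has additive order \<open>m\<close> modulo
  \<open>v\<close>.\<close>

lemma card_progression:
  fixes x c v :: int and m :: nat
  assumes "m > 0" "\<And>i. v dvd i * c \<longleftrightarrow> int m dvd i"
  shows "card ((\<lambda>i. (x + int i * c) mod v) ` UNIV) = m"
proof -
  have eq: "(x + int i * c) mod v = (x + int j * c) mod v \<longleftrightarrow> [i = j] (mod m)" for i j
  proof -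
    have "(x + int i * c) mod v = (x + int j * c) mod v \<longleftrightarrow> v dvd (int i - int j) * c"
      by (simp add: mod_eq_dvd_iff algebra_simps)
    also have "\<dots> \<longleftrightarrow> [int i = int j] (mod int m)"
      by (simp add: assms(2) cong_iff_dvd_diff)
    finally show ?thesis by (simp add: cong_int_iff)
  qed
  have "(\<lambda>i. (x + int i * c) mod v) ` UNIV = (\<lambda>i. (x + int i * c) mod v) ` {..<m}"
  proof (intro equalityI subsetI)
    fix z assume "z \<in> (\<lambda>i. (x + int i * c) mod v) ` UNIV"
    then obtain i where "z = (x + int i * c) mod v" by blast
    then have "z = (x + int (i mod m) * c) mod v" using eq[of i "i mod m"] by (simp add: cong_def)
    then show "z \<in> (\<lambda>i. (x + int i * c) mod v) ` {..<m}" using assms(1) by auto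
  qed auto
  moreover have "inj_on (\<lambda>i. (x + int i * c) mod v) {..<m}"
    by (rule inj_onI) (simp add: eq cong_def)
  ultimately show ?thesis by (simp add: card_image)
qed

section \<open>Actions on points, lines and residue classes\<close>

context sidon_set
begin

lemma point_action: "set_action A {0..<v} fst"
  by unfold_locales (use zperm_range[OF A_zperm(1)] v_pos in auto)

lemma line_action: "set_action A {0..<v} snd"
  by unfold_locales (use zperm_range[OF A_zperm(2)] v_pos in auto)

lemma commute_transl_cong:
  assumes "u \<in> carrier A" "u \<otimes>\<^bsub>A\<^esub> transl v e = transl v e \<otimes>\<^bsub>A\<^esub> u"
  shows "[fst u (x + e) = fst u x + e] (mod v)" "[snd u (x + e) = snd u x + e] (mod v)"
proof -
  have "fst (u \<otimes>\<^bsub>A\<^esub> transl v e) x = fst (transl v e \<otimes>\<^bsub>A\<^esub> u) x"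
    "snd (u \<otimes>\<^bsub>A\<^esub> transl v e) x = snd (transl v e \<otimes>\<^bsub>A\<^esub> u) x"
    by (simp_all only: assms(2))
  then show "[fst u (x + e) = fst u x + e] (mod v)" "[snd u (x + e) = snd u x + e] (mod v)"
    using A_zperm[OF assms(1)] by (simp_all add: cong_def)
qed

text \<open>A map commuting with the translation by \<open>e\<close> permutes the residue classes
  modulo \<open>e\<close>. The projection \<open>\<pi>\<close> treats points and lines at
  once.\<close>

lemma centralizer_mod:
  assumes u: "u \<in> carrier A" "u \<otimes>\<^bsub>A\<^esub> transl v e = transl v e \<otimes>\<^bsub>A\<^esub> u"
    and e: "e dvd v" and \<pi>: "\<pi> = fst \<or> \<pi> = snd"
  shows "\<pi> u (x mod e) mod e = \<pi> u x mod e"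
proof -
  have "[\<pi> u (x + e) = \<pi> u x + e] (mod v)" for x
    using \<pi> commute_transl_cong[OF u, of x] by auto
  then have "[\<pi> u (x mod e + e * (x div e)) = \<pi> u (x mod e) + e * (x div e)] (mod v)"
    by (rule shift_multiple)
  then have "[\<pi> u (x mod e + e * (x div e)) = \<pi> u (x mod e) + e * (x div e)] (mod e)"
    using e by (rule cong_dvd_modulus)
  then show ?thesis by (simp add: cong_def)
qed

lemma block_action:
  assumes e: "e > 0" "e dvd v" and \<pi>: "\<pi> = fst \<or> \<pi> = snd"
  shows "set_action (A\<lparr>carrier := {u \<in> carrier A. u \<otimes>\<^bsub>A\<^esub> transl v e = transl v e \<otimes>\<^bsub>A\<^esub> u}\<rparr>)
           {0..<e} (\<lambda>u x. \<pi> u x mod e)"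
    (is "set_action (A\<lparr>carrier := ?N\<rparr>) _ _")
proof -
  have N: "subgroup ?N A" by (rule centralizer_subgroup) simp
  interpret N: group "A\<lparr>carrier := ?N\<rparr>" by (rule subgroup_imp_group[OF N])
  have mod: "\<pi> u (x mod e) mod e = \<pi> u x mod e" if "u \<in> ?N" for u x
    using that by (intro centralizer_mod[OF _ _ e(2) \<pi>]) auto
  show ?thesis
  proof unfold_locales
    fix g h x assume "g \<in> carrier (A\<lparr>carrier := ?N\<rparr>)" "h \<in> carrier (A\<lparr>carrier := ?N\<rparr>)"
    then show "\<pi> (g \<otimes>\<^bsub>A\<lparr>carrier := ?N\<rparr>\<^esub> h) x mod e = \<pi> g (\<pi> h x mod e) mod e"
      using mod \<pi> by auto
  next
    fix x assume "x \<in> {0..<e}"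
    then show "\<pi> \<one>\<^bsub>A\<lparr>carrier := ?N\<rparr>\<^esub> x mod e = x"
      using \<pi> e by (auto simp: mod_mod_cancel)
  qed (use e in auto)
qed

end

section \<open>Conjugation into the translations for two distinct primes\<close>

context connected_sidon_set
begin

text \<open>Because \<open>v < q\<^sup>2\<close>, \<open>acts_as_cycle\<close> applies to points and
  to lines: on each residue class modulo \<open>p\<close> the map \<open>u\<close> is a translation
  by some multiple of \<open>p\<close>. Connectedness then makes these translations agree.\<close>

lemma q_subgroup_transl:
  assumes v: "v = int p * int q" and p: "0 < p" "p < q" and q: "prime q"
    and Q: "subgroup Q A" "card Q = q ^ k" "transl v (int p) \<in> Q" and u: "u \<in> Q"
  obtains t where "u = transl v t"
proof -
  have uc: "u \<in> carrier A" by (rule subgroup.mem_carrier[OF Q(1) u])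
  \<comment> \<open>The amount \<open>i\<close> may still depend on the class of \<open>x\<close>,
    and may differ between points and lines.\<close>
  have loc: "\<exists>i::nat. \<forall>y. [y = x] (mod int p) \<longrightarrow> \<pi> u y = (y + int i * int p) mod v"
    if \<pi>: "\<pi> = fst \<or> \<pi> = snd" for \<pi> x
  proof -
    have "set_action A {0..<v} \<pi>" using \<pi> point_action line_action by blast
    then interpret S: set_action A "{0..<v}" \<pi> .
    interpret SQ: set_action "A\<lparr>carrier := Q\<rparr>" "{0..<v}" \<pi>
      by (rule S.restrict_to_subgroup[OF Q(1)])
    interpret SQ: p_group_action "A\<lparr>carrier := Q\<rparr>" "{0..<v}" \<pi> q k
      by unfold_locales (use q Q in \<open>auto simp: order_def\<close>)
    define D where "D = (\<lambda>i::nat. \<pi> (transl v (int p) [^]\<^bsub>A\<lparr>carrier := Q\<rparr>\<^esub> i) (x mod v)) ` UNIV"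
    have pow: "\<pi> (transl v (int p) [^]\<^bsub>A\<lparr>carrier := Q\<rparr>\<^esub> i) y = (y + int i * int p) mod v" for i :: nat and y
      using \<pi> by (auto simp: nat_pow_consistent[symmetric] transl_pow)
    have D: "D = (\<lambda>i. (x + int i * int p) mod v) ` UNIV"
      unfolding D_def pow by (simp add: mod_simps)
    have "card D = q"
      unfolding D
    proof (rule card_progression)
      show "v dvd i * int p \<longleftrightarrow> int q dvd i" for i
        using p v by (simp add: mult.commute[of i])
    qed (use p in simp)
    moreover have "card {0..<v} < q\<^sup>2"
      using p v by (simp add: power2_eq_square nat_mult_distrib)
    ultimately obtain i :: nat where i: "\<And>y. y \<in> D \<Longrightarrow> \<pi> u y = (y + int i * int p) mod v"
      using SQ.acts_as_cycle[of "x mod v" "transl v (int p)" D u] D_def Q(3) u v_pos unfolding pow by auto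
    have "\<pi> u y = (y + int i * int p) mod v" if yx: "[y = x] (mod int p)" for y
    proof -
      obtain j where j: "y = x + int p * j"
        using cong_sym[OF yx] unfolding cong_iff_lin by blast
      have "y mod v = (x + int (nat (j mod int q)) * int p) mod v"
      proof -
        have "int p * j mod v = int p * (j mod int q)" unfolding v by (simp add: mod_mult_mult1)
        then have "(x + int p * j) mod v = (x + int p * (j mod int q)) mod v" by (metis mod_add_right_eq)
        moreover have "int (nat (j mod int q)) = j mod int q" using p by simp
        ultimately show ?thesis unfolding j by (simp add: mult.commute)
      qed
      then have "y mod v \<in> D" unfolding D by blast
      then have "\<pi> u (y mod v) = (y mod v + int i * int p) mod v" by (rule i)
      moreover have "\<pi> u (y mod v) = \<pi> u y" using \<pi> A_zperm[OF uc] by auto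
      ultimately show ?thesis by (simp add: mod_simps)
    qed
    then show ?thesis by blast
  qed
  have pd: "int p dvd v" using v by simp
  have fix_mod: "[\<pi> u x = x] (mod int p)" if \<pi>: "\<pi> = fst \<or> \<pi> = snd" for \<pi> x
  proof -
    obtain i :: nat where "\<pi> u x = (x + int i * int p) mod v" using loc[OF \<pi>, of x] by auto
    then show ?thesis by (simp add: cong_def mod_mod_cancel[OF pd])
  qed
  have "[fst u (x + int p) = fst u x + int p] (mod v)" for x
  proof -
    obtain i :: nat where i: "\<And>y. [y = x] (mod int p) \<Longrightarrow> fst u y = (y + int i * int p) mod v"
      using loc[of fst x] by auto
    have "fst u (x + int p) = (x + int p + int i * int p) mod v" by (rule i) (simp add: cong_def)
    moreover have "fst u x = (x + int i * int p) mod v" by (rule i) simp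
    ultimately show ?thesis by (simp add: cong_def mod_simps algebra_simps)
  qed
  then show thesis
    using block_translation_is_transl[OF uc, of "int p"] fix_mod that by blast
qed

text \<open>Such a \<open>u\<close> shifts each class of points modulo \<open>p\<close> within
  itself by a constant multiple of \<open>p\<close>, so its order divides \<open>q\<close>. The
  \<open>q\<close>-group generated by \<open>u\<close> can only fix the \<open>p < q\<close> classes
  of lines, and \<open>block_translation_is_transl\<close> applies.\<close>

lemma central_block_fixing_transl:
  assumes v: "v = int p * int q" and p: "0 < p" "p < q" and q: "prime q"
    and u: "u \<in> carrier A" "u \<otimes>\<^bsub>A\<^esub> transl v (int p) = transl v (int p) \<otimes>\<^bsub>A\<^esub> u"
    and fix_blocks: "\<And>x. [fst u x = x] (mod int p)"
  obtains t where "u = transl v t"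
proof -
  let ?N = "{u \<in> carrier A. u \<otimes>\<^bsub>A\<^esub> transl v (int p) = transl v (int p) \<otimes>\<^bsub>A\<^esub> u}"
  note comm = commute_transl_cong[OF u]
  \<comment> \<open>The displacement of \<open>x\<close> is a multiple of \<open>p\<close>, and
    \<open>u\<close> commutes with translations by such multiples, so each application of
    \<open>u\<close> repeats the same displacement.\<close>
  have pow: "[fst (u [^]\<^bsub>A\<^esub> i) x = x + int i * (fst u x - x)] (mod v)" for i :: nat and x
  proof (induction i)
    case 0
    then show ?case by (simp add: cong_def)
  next
    case (Suc i)
    obtain m where m: "fst u x - x = int p * m"
      using fix_blocks[of x] by (auto simp: cong_iff_dvd_diff)
    have "fst (u [^]\<^bsub>A\<^esub> Suc i) x = fst u (fst (u [^]\<^bsub>A\<^esub> i) x)"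
      by (subst nat_pow_Suc2) (use u in auto)
    also have "[fst u (fst (u [^]\<^bsub>A\<^esub> i) x) = fst u (x + int p * (int i * m))] (mod v)"
      using Suc m A_zperm(1)[OF u(1)] by (simp add: zperm_cong_iff algebra_simps)
    also have "[fst u (x + int p * (int i * m)) = fst u x + int p * (int i * m)] (mod v)"
      by (rule shift_multiple) (rule comm)
    finally show ?case using m by (simp add: algebra_simps)
  qed
  have uq: "u [^]\<^bsub>A\<^esub> q = \<one>\<^bsub>A\<^esub>"
  proof -
    have "u [^]\<^bsub>A\<^esub> q = transl v 0"
    proof (rule transl_if_fst)
      show "u [^]\<^bsub>A\<^esub> q \<in> carrier A" using u(1) by (rule nat_pow_closed)
      fix x
      have "int p * int q dvd (fst u x - x) * int q"
        using fix_blocks[of x] by (intro mult_dvd_mono) (simp_all add: cong_iff_dvd_diff)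
      then have "[x + int q * (fst u x - x) = x + 0] (mod v)"
        by (intro cong_add) (simp_all add: cong_0_iff v mult.commute)
      then show "[fst (u [^]\<^bsub>A\<^esub> q) x = x + 0] (mod v)" using pow cong_trans by blast
    qed
    then show ?thesis by (simp add: transl_zero)
  qed
  have N: "subgroup ?N A" by (rule centralizer_subgroup) simp
  let ?U = "generate A {u}"
  have U: "subgroup ?U A" using u by (intro generate_is_subgroup) auto
  have UN: "?U \<subseteq> ?N" using u N by (intro generate_subgroup_incl) auto
  have "card ?U dvd q ^ 1"
    using uq u pow_eq_id generate_pow_card by (metis power_one_right)
  then obtain b where b: "card ?U = q ^ b" using divides_primepow_nat[OF q] by blast
  interpret B: set_action "A\<lparr>carrier := ?N\<rparr>" "{0..<int p}" "\<lambda>u x. snd u x mod int p"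
    by (rule block_action) (use v p in auto)
  have "subgroup ?U (A\<lparr>carrier := ?N\<rparr>)" using U N UN by (rule subgroup_incl)
  then have "set_action (A\<lparr>carrier := ?U\<rparr>) {0..<int p} (\<lambda>u x. snd u x mod int p)"
    using B.restrict_to_subgroup by fastforce
  then interpret U: set_action "A\<lparr>carrier := ?U\<rparr>" "{0..<int p}" "\<lambda>u x. snd u x mod int p" .
  interpret U: p_group_action "A\<lparr>carrier := ?U\<rparr>" "{0..<int p}" "\<lambda>u x. snd u x mod int p" q b
    by unfold_locales (use q b in \<open>auto simp: order_def\<close>)
  have uU: "u \<in> ?U" by (simp add: generate.incl)
  have snd0: "snd u x mod int p = x" if "x \<in> {0..<int p}" for x
    using uU p by (intro U.fixed_if_small_orbit[OF that, of "{0..<int p}" u]) auto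
  have "[snd u y = y] (mod int p)" for y
    using snd0[of "y mod int p"] centralizer_mod[OF u, of snd y] p v by (simp add: cong_def)
  then show thesis
    using block_translation_is_transl[OF u(1) fix_blocks _ comm(1)] that by blast
qed


text \<open>The first conjugation makes the \<open>p\<close>-th power of \<open>w\<close> a
  translation. The second takes place in the centraliser of the translation by \<open>p\<close>: it
  keeps that power and makes the \<open>q\<close>-th power a translation too. As \<open>p\<close>
  and \<open>q\<close> are coprime, the conjugate of \<open>w\<close> itself is a
  translation.\<close>

lemma conj_into_translations_pq:
  assumes v: "v = int p * int q" and p: "prime p" and q: "prime q" and pq: "p < q"
    and w: "w \<in> carrier A" "w [^]\<^bsub>A\<^esub> (p * q) = \<one>\<^bsub>A\<^esub>" "w [^]\<^bsub>A\<^esub> p \<noteq> \<one>\<^bsub>A\<^esub>"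
  obtains g t where "g \<in> carrier A" "g \<otimes>\<^bsub>A\<^esub> w \<otimes>\<^bsub>A\<^esub> inv\<^bsub>A\<^esub> g = transl v t"
proof -
  have pos: "0 < p" "0 < q" using p q prime_gt_0_nat by auto
  have cop: "coprime p q" using p q pq by (simp add: primes_coprime)
  have "transl v (int p) [^]\<^bsub>A\<^esub> (q ^ 1) = \<one>\<^bsub>A\<^esub>"
    by (simp add: transl_pow transl_eq_one_iff) (simp add: v)
  then obtain Q k where Q: "subgroup Q A" "card Q = q ^ k" "transl v (int p) \<in> Q"
    and Qc: "\<And>u j. \<lbrakk>u \<in> carrier A; u [^]\<^bsub>A\<^esub> (q ^ j :: nat) = \<one>\<^bsub>A\<^esub>\<rbrakk> \<Longrightarrow> \<exists>x\<in>carrier A. x \<otimes>\<^bsub>A\<^esub> u \<otimes>\<^bsub>A\<^esub> inv\<^bsub>A\<^esub> x \<in> Q"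
    using sylow_containing[OF fin_A q, of "transl v (int p)" 1] by (metis transl_closed)
  have "(w [^]\<^bsub>A\<^esub> p) [^]\<^bsub>A\<^esub> (q ^ 1) = \<one>\<^bsub>A\<^esub>" using w by (simp add: nat_pow_pow)
  then obtain g1 where g1: "g1 \<in> carrier A" "g1 \<otimes>\<^bsub>A\<^esub> w [^]\<^bsub>A\<^esub> p \<otimes>\<^bsub>A\<^esub> inv\<^bsub>A\<^esub> g1 \<in> Q"
    using Qc[of "w [^]\<^bsub>A\<^esub> p" 1] w(1) nat_pow_closed by blast
  define w1 where "w1 = g1 \<otimes>\<^bsub>A\<^esub> w \<otimes>\<^bsub>A\<^esub> inv\<^bsub>A\<^esub> g1"
  have w1: "w1 \<in> carrier A" unfolding w1_def using g1(1) w(1) by (metis inv_closed m_closed)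
  have w1_pow: "w1 [^]\<^bsub>A\<^esub> n = g1 \<otimes>\<^bsub>A\<^esub> w [^]\<^bsub>A\<^esub> n \<otimes>\<^bsub>A\<^esub> inv\<^bsub>A\<^esub> g1" for n :: nat
    unfolding w1_def using g1(1) w(1) by (rule conj_pow)
  obtain t where t: "w1 [^]\<^bsub>A\<^esub> p = transl v t"
    using q_subgroup_transl[OF v pos(1) pq q Q g1(2)] unfolding w1_pow .
  have "transl v t \<noteq> \<one>\<^bsub>A\<^esub>"
    using w(3) g1(1) w(1) nat_pow_closed[OF w(1)] unfolding t[symmetric] w1_pow
    by (metis conj_eq_one)
  then have nv: "\<not> v dvd t" by (simp add: transl_eq_one_iff)
  have "w1 [^]\<^bsub>A\<^esub> (p * q) = \<one>\<^bsub>A\<^esub>"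
    unfolding w1_pow w(2) using g1(1) by simp
  then have w1_order: "(w1 [^]\<^bsub>A\<^esub> p) [^]\<^bsub>A\<^esub> q = \<one>\<^bsub>A\<^esub>" "(w1 [^]\<^bsub>A\<^esub> q) [^]\<^bsub>A\<^esub> p = \<one>\<^bsub>A\<^esub>"
    by (simp_all add: nat_pow_pow[OF w1] mult.commute)
  then have "transl v t [^]\<^bsub>A\<^esub> q = \<one>\<^bsub>A\<^esub>" unfolding t by simp
  then have "v dvd int q * t" by (simp add: transl_pow transl_eq_one_iff)
  then have "int p dvd t" using v pos by (simp add: mult.commute)
  then obtain t' where t': "t = int p * t'" by blast
  have "\<not> int q dvd t'" using nv t' v pos by simp
  then have "coprime t' (int q)" using q by (simp add: coprime_commute[of t'] prime_imp_coprime)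
  \<comment> \<open>Inverting \<open>t'\<close> modulo \<open>q\<close> exhibits the translation by
    \<open>p\<close> as a power of \<open>transl v t\<close>; everything commuting with the latter
    then centralises the former.\<close>
  then obtain m where m: "[t' * m = 1] (mod int q)" using cong_solve_coprime_int by blast
  define m' where "m' = nat (m mod int q)"
  have "[t' * int m' = 1] (mod int q)"
    using m pos unfolding m'_def by (simp add: cong_def mod_simps)
  then have "[int p * (t' * int m') = int p * 1] (mod int p * int q)"
    unfolding cong_iff_dvd_diff right_diff_distrib[symmetric] by (rule mult_dvd_mono[OF dvd_refl])
  then have sig: "transl v t [^]\<^bsub>A\<^esub> m' = transl v (int p)"
    by (simp add: transl_pow transl_eq_iff) (simp add: t' v algebra_simps)
  have "w1 [^]\<^bsub>A\<^esub> p \<otimes>\<^bsub>A\<^esub> w1 = w1 \<otimes>\<^bsub>A\<^esub> w1 [^]\<^bsub>A\<^esub> p"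
    using w1 by (intro group_commutes_pow) auto
  then have w1_comm: "w1 \<otimes>\<^bsub>A\<^esub> transl v (int p) = transl v (int p) \<otimes>\<^bsub>A\<^esub> w1"
    unfolding sig[symmetric] t using w1 by (intro group_commutes_pow[symmetric]) auto
  let ?N = "{u \<in> carrier A. u \<otimes>\<^bsub>A\<^esub> transl v (int p) = transl v (int p) \<otimes>\<^bsub>A\<^esub> u}"
  have N: "subgroup ?N A" by (rule centralizer_subgroup) simp
  let ?GN = "A\<lparr>carrier := ?N\<rparr>"
  interpret GN: group ?GN by (rule subgroup_imp_group[OF N])
  have finN: "finite (carrier ?GN)" using fin_A by simp
  have rho: "transl v (int q) \<in> carrier ?GN" by (simp add: transl_mult add.commute)
  have "transl v (int q) [^]\<^bsub>?GN\<^esub> (p ^ 1) = \<one>\<^bsub>?GN\<^esub>"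
    by (simp add: nat_pow_consistent[symmetric] transl_pow transl_eq_one_iff) (simp add: v)
  then obtain R k' where R: "subgroup R ?GN" "card R = p ^ k'" "transl v (int q) \<in> R"
    and Rc: "\<And>u j. \<lbrakk>u \<in> carrier ?GN; u [^]\<^bsub>?GN\<^esub> (p ^ j :: nat) = \<one>\<^bsub>?GN\<^esub>\<rbrakk> \<Longrightarrow> \<exists>x\<in>carrier ?GN. x \<otimes>\<^bsub>?GN\<^esub> u \<otimes>\<^bsub>?GN\<^esub> inv\<^bsub>?GN\<^esub> x \<in> R"
    using GN.sylow_containing[OF finN p rho, of 1] by blast
  have w1q: "w1 [^]\<^bsub>A\<^esub> q \<in> ?N"
    using w1 w1_comm by (simp add: group_commutes_pow nat_pow_closed)
  have "(w1 [^]\<^bsub>A\<^esub> q) [^]\<^bsub>?GN\<^esub> (p ^ 1) = \<one>\<^bsub>?GN\<^esub>"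
    using w1_order by (simp add: nat_pow_consistent[symmetric])
  \<comment> \<open>Choosing \<open>g2\<close> inside the centraliser ensures that the second
    conjugation does not disturb the translation reached by the first.\<close>
  then obtain g2 where g2N: "g2 \<in> ?N" and g2R: "g2 \<otimes>\<^bsub>A\<^esub> w1 [^]\<^bsub>A\<^esub> q \<otimes>\<^bsub>A\<^esub> inv\<^bsub>A\<^esub> g2 \<in> R"
    using Rc[of "w1 [^]\<^bsub>A\<^esub> q" 1] w1q m_inv_consistent[OF N] by auto
  have g2: "g2 \<in> carrier A" using g2N by blast
  define r where "r = g2 \<otimes>\<^bsub>A\<^esub> w1 [^]\<^bsub>A\<^esub> q \<otimes>\<^bsub>A\<^esub> inv\<^bsub>A\<^esub> g2"
  have rR: "r \<in> R" unfolding r_def by (rule g2R)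
  then have rN: "r \<in> ?N" using subgroup.mem_carrier[OF R(1)] by simp
  then have rc: "r \<in> carrier A" and r_comm: "r \<otimes>\<^bsub>A\<^esub> transl v (int p) = transl v (int p) \<otimes>\<^bsub>A\<^esub> r" by blast+
  have pv: "int p dvd v" using v by simp
  interpret B: set_action ?GN "{0..<int p}" "\<lambda>u x. fst u x mod int p"
    by (rule block_action) (use v pos in auto)
  interpret BR: set_action "?GN\<lparr>carrier := R\<rparr>" "{0..<int p}" "\<lambda>u x. fst u x mod int p"
    by (rule B.restrict_to_subgroup[OF R(1)])
  interpret BR: p_group_action "?GN\<lparr>carrier := R\<rparr>" "{0..<int p}" "\<lambda>u x. fst u x mod int p" p k'
    by unfold_locales (use p R in \<open>auto simp: order_def\<close>)
  have pow: "fst (transl v (int q) [^]\<^bsub>?GN\<lparr>carrier := R\<rparr>\<^esub> i) y mod int p = (y + int i * int q) mod int p" for i :: nat and y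
    by (simp add: nat_pow_consistent[symmetric] transl_pow mod_mod_cancel[OF pv])
  define D where "D = (\<lambda>i::nat. fst (transl v (int q) [^]\<^bsub>?GN\<lparr>carrier := R\<rparr>\<^esub> i) 0 mod int p) ` UNIV"
  have cardD: "card D = p"
    unfolding D_def pow
  proof (rule card_progression)
    show "int p dvd i * int q \<longleftrightarrow> int p dvd i" for i
      using cop by (simp add: coprime_dvd_mult_left_iff)
  qed (use pos in simp)
  have "D \<subseteq> {0..<int p}" unfolding D_def using pos by auto
  then have D: "D = {0..<int p}" using cardD by (intro card_subset_eq) auto
  \<comment> \<open>The translation by \<open>q\<close> permutes all \<open>p\<close> classes in a
    single cycle, so \<open>R\<close> acts on them by powers of this cycle.\<close>
  have "card {0..<int p} < p\<^sup>2" using prime_gt_1_nat[OF p] by (simp add: power2_eq_square)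
  then obtain i :: nat where i: "\<And>y. y \<in> D \<Longrightarrow> fst r y mod int p = (y + int i * int q) mod int p"
    using BR.acts_as_cycle[of 0 "transl v (int q)" D r] cardD R(3) rR pos unfolding D_def pow by auto
  \<comment> \<open>Undoing the rotation of the classes leaves an element of the centraliser that
    fixes each of them.\<close>
  define u where "u = transl v (- (int i * int q)) \<otimes>\<^bsub>A\<^esub> r"
  have "transl v (- (int i * int q)) \<in> ?N" by (simp add: transl_mult add.commute)
  then have uN: "u \<in> ?N" unfolding u_def using rN subgroup.m_closed[OF N] by blast
  have "[fst u x = x] (mod int p)" for x
  proof -
    have "fst r x mod int p = fst r (x mod int p) mod int p"
      using centralizer_mod[OF rc r_comm pv, of fst x] by simp
    also have "\<dots> = (x + int i * int q) mod int p"
      using i[of "x mod int p"] pos by (simp add: D mod_simps)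
    finally have "[fst r x - int i * int q = x + int i * int q - int i * int q] (mod int p)"
      by (intro cong_diff) (simp_all add: cong_def)
    then show ?thesis unfolding u_def by (simp add: cong_def mod_mod_cancel[OF pv])
  qed
  then obtain t2 where t2: "u = transl v t2"
    using central_block_fixing_transl[OF v pos(1) pq q, of u] uN by blast
  have "r = transl v (int i * int q) \<otimes>\<^bsub>A\<^esub> u"
    unfolding u_def using rc
    by (simp add: m_assoc[symmetric] transl_mult l_one flip: transl_zero)
  then have r: "r = transl v (int i * int q + t2)" unfolding t2 by (simp add: transl_mult)
  define w2 where "w2 = g2 \<otimes>\<^bsub>A\<^esub> w1 \<otimes>\<^bsub>A\<^esub> inv\<^bsub>A\<^esub> g2"
  have w2: "w2 \<in> carrier A" unfolding w2_def using g2 w1 by (metis inv_closed m_closed)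
  have w2_pow: "w2 [^]\<^bsub>A\<^esub> n = g2 \<otimes>\<^bsub>A\<^esub> w1 [^]\<^bsub>A\<^esub> n \<otimes>\<^bsub>A\<^esub> inv\<^bsub>A\<^esub> g2" for n :: nat
    unfolding w2_def using g2 w1 by (rule conj_pow)
  have w2q: "w2 [^]\<^bsub>A\<^esub> q = transl v (int i * int q + t2)" unfolding w2_pow r[symmetric] r_def ..
  have "transl v t = transl v (int p) [^]\<^bsub>A\<^esub> nat (t' mod int q)"
  proof -
    have "int p * (t' mod int q) = t mod v" unfolding t' v by (simp add: mod_mult_mult1)
    then show ?thesis using pos by (simp add: transl_pow transl_eq_iff mult.commute)
  qed
  then have "g2 \<otimes>\<^bsub>A\<^esub> transl v t = transl v t \<otimes>\<^bsub>A\<^esub> g2"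
    using g2N group_commutes_pow[of "transl v (int p)" g2] by simp
  then have w2p: "w2 [^]\<^bsub>A\<^esub> p = transl v t"
    unfolding w2_pow t using g2 by (simp add: m_assoc)
  \<comment> \<open>A Bezout relation expresses \<open>w2\<close> through its \<open>p\<close>-th
    and \<open>q\<close>-th powers, both of which are translations.\<close>
  obtain x where "[p * x = 1] (mod q)" using cong_solve_coprime_nat[OF cop] by auto
  then obtain y where y: "p * x = y * q + 1"
    using prime_gt_1_nat[OF q] by (metis cong_def mod_less mult.commute mod_div_mult_eq add.commute div_mult_mod_eq)
  have "(w2 [^]\<^bsub>A\<^esub> p) [^]\<^bsub>A\<^esub> x = (w2 [^]\<^bsub>A\<^esub> q) [^]\<^bsub>A\<^esub> y \<otimes>\<^bsub>A\<^esub> w2"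
    using w2 y by (simp add: nat_pow_pow mult.commute[of q])
  then have "w2 = inv\<^bsub>A\<^esub> ((w2 [^]\<^bsub>A\<^esub> q) [^]\<^bsub>A\<^esub> y) \<otimes>\<^bsub>A\<^esub> (w2 [^]\<^bsub>A\<^esub> p) [^]\<^bsub>A\<^esub> x"
    using w2 nat_pow_closed by (simp add: inv_solve_left)
  then obtain t4 where t4: "w2 = transl v t4"
    unfolding w2p w2q transl_pow transl_inv transl_mult by blast
  have "(g2 \<otimes>\<^bsub>A\<^esub> g1) \<otimes>\<^bsub>A\<^esub> w \<otimes>\<^bsub>A\<^esub> inv\<^bsub>A\<^esub> (g2 \<otimes>\<^bsub>A\<^esub> g1) = w2"
    unfolding w2_def w1_def using g1(1) g2 w(1)
    by (simp add: inv_mult_group m_assoc)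
  then show thesis using that[of "g2 \<otimes>\<^bsub>A\<^esub> g1" t4] g1(1) g2 t4 m_closed by metis
qed

end

section \<open>Prime powers\<close>

lemma fermat_int:
  fixes b :: int
  assumes "prime p"
  shows "[b ^ p = b] (mod int p)"
proof (cases "int p dvd b")
  case True
  then have "int p dvd b ^ p" using assms by (meson dvd_power dvd_trans prime_gt_0_nat)
  then show ?thesis using True by (simp add: cong_iff_dvd_diff)
next
  case False
  define c where "c = nat (b mod int p)"
  have c: "int c = b mod int p" unfolding c_def using assms by (simp add: prime_gt_0_nat)
  have "\<not> p dvd c" using False c by (metis dvd_mod_iff dvd_refl int_dvd_int_iff)
  then have "[c ^ (p - 1) = 1] (mod p)" using assms by (rule fermat_theorem[rotated])
  then have "[c ^ (p - 1) * c = 1 * c] (mod p)" by (intro cong_mult) auto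
  then have "[c ^ p = c] (mod p)"
    using power_minus_mult[OF prime_gt_0_nat[OF assms], of c] by simp
  then have "[int c ^ p = int c] (mod int p)" by (metis cong_int_iff of_nat_power)
  then show ?thesis unfolding c by (simp add: cong_def power_mod)
qed

text \<open>In \<open>b ^ p - 1 = (b - 1) * (\<Sum>i<p. b ^ i)\<close> the sum is \<open>p\<close>
  times a number prime to \<open>p\<close>, so \<open>b - 1\<close> carries all but one of the
  factors \<open>p\<close>. For \<open>p = 2\<close> the sum is \<open>b + 1\<close>, which is why
  \<open>b\<close> is taken modulo 4.\<close>

lemma cong_one_if_pth_power_cong_one:
  fixes b :: int
  assumes p: "prime p" and n: "n \<ge> 1" and pow: "[b ^ p = 1] (mod int p ^ n)"
    and two: "p = 2 \<Longrightarrow> [b = 1] (mod 4)"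
  shows "[b = 1] (mod int p ^ (n - 1))"
proof -
  have "[b ^ p = 1] (mod int p)"
    using pow n by (metis cong_dvd_modulus dvd_power_le dvd_refl power_one_right)
  then have "[b = 1] (mod int p)" using fermat_int[OF p, of b] cong_trans cong_sym by blast
  then obtain c where c: "b = 1 + int p * c"
    by (metis cong_iff_lin cong_sym)
  have "[(\<Sum>i<p. b ^ i) = int p] (mod (int p)\<^sup>2)"
  proof (cases "p = 2")
    case True
    then show ?thesis using two by (simp add: numeral_2_eq_2 cong_iff_dvd_diff)
  next
    case False
    then have "odd p" using p prime_odd_nat prime_ge_2_nat[OF p] by force
    then obtain h where h: "p = 2 * h + 1" by (rule oddE)
    have bi: "[b ^ i = 1 + int i * (int p * c)] (mod (int p)\<^sup>2)" for i
    proof (induction i)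
      case (Suc i)
      have "[b * b ^ i = (1 + int p * c) * (1 + int i * (int p * c))] (mod (int p)\<^sup>2)"
        unfolding c using Suc[unfolded c] by (intro cong_mult) auto
      also have "(1 + int p * c) * (1 + int i * (int p * c))
          = 1 + int (Suc i) * (int p * c) + (int p)\<^sup>2 * (int i * c * c)"
        by (simp add: algebra_simps power2_eq_square)
      also have "[1 + int (Suc i) * (int p * c) + (int p)\<^sup>2 * (int i * c * c) = 1 + int (Suc i) * (int p * c)] (mod (int p)\<^sup>2)"
        by (simp add: cong_iff_dvd_diff)
      finally show ?case by simp
    qed simp
    have "[(\<Sum>i<p. b ^ i) = (\<Sum>i<p. 1 + int i * (int p * c))] (mod (int p)\<^sup>2)"
      by (rule cong_sum) (rule bi)
    also have "(\<Sum>i<p. 1 + int i * (int p * c)) = int p + (\<Sum>i<p. int i) * (int p * c)"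
      by (simp add: sum.distrib sum_distrib_right)
    \<comment> \<open>For odd \<open>p\<close> the sum of the exponents is itself divisible by
      \<open>p\<close>, so the linear terms vanish modulo the square of \<open>p\<close>.\<close>
    also have "(\<Sum>i<p. int i) = int p * int h"
    proof -
      have "(\<Sum>i<2 * h + 1. int i) = int (2 * h + 1) * int h"
        by (induction h) (auto simp: algebra_simps)
      then show ?thesis using h by simp
    qed
    also have "[int p + int p * int h * (int p * c) = int p] (mod (int p)\<^sup>2)"
      by (simp add: cong_iff_dvd_diff power2_eq_square)
    finally show ?thesis .
  qed
  from cong_sym[OF this] obtain j where "(\<Sum>i<p. b ^ i) = int p + (int p)\<^sup>2 * j"
    unfolding cong_iff_lin by blast
  then have j: "(\<Sum>i<p. b ^ i) = int p * (1 + int p * j)"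
    by (simp add: algebra_simps power2_eq_square)
  have pn: "int p ^ n = int p ^ (n - 1) * int p" using power_minus_mult[of n "int p"] n by simp
  have "int p ^ (n - 1) * int p dvd (b - 1) * (1 + int p * j) * int p"
    using pow unfolding pn[symmetric] cong_iff_dvd_diff
    by (simp add: power_diff_1_eq j algebra_simps)
  then have "int p ^ (n - 1) dvd (b - 1) * (1 + int p * j)"
    using prime_gt_0_nat[OF p] by simp
  moreover have "coprime (int p ^ (n - 1)) (1 + int p * j)"
  proof -
    have "coprime (int p) (1 + int p * j)"
      by (rule coprimeI) (metis dvd_add_left_iff dvd_mult2)
    then show ?thesis by simp
  qed
  ultimately show ?thesis
    by (simp add: cong_iff_dvd_diff coprime_dvd_mult_left_iff)
qed

text \<open>Every nontrivial subgroup of a cyclic \<open>p\<close>-group contains the subgroup of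
  order \<open>p\<close>: the gcd of \<open>t\<close> and \<open>p ^ n\<close> is a proper power of
  \<open>p\<close> and thus divides \<open>p ^ (n - 1)\<close>.\<close>

lemma multiple_cong_prime_power:
  fixes t :: int
  assumes p: "prime p" and n: "n \<ge> 1" and t: "\<not> int p ^ n dvd t"
  obtains m :: nat where "[int m * t = int p ^ (n - 1)] (mod int p ^ n)"
proof -
  have "gcd t (int p ^ n) dvd int p ^ n" by simp
  then obtain i where i: "i \<le> n" "gcd t (int p ^ n) = int p ^ i"
    using divides_primepow[of "int p" "gcd t (int p ^ n)" n] p by auto
  have "i \<noteq> n" using i t by (metis gcd_dvd1)
  then have "gcd t (int p ^ n) dvd int p ^ (n - 1)" using i by (simp add: le_imp_power_dvd)
  then obtain d where d: "int p ^ (n - 1) = gcd t (int p ^ n) * d" by blast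
  obtain x y where xy: "x * t + y * int p ^ n = gcd t (int p ^ n)" using bezout_int by blast
  let ?m = "nat ((x * d) mod int p ^ n)"
  have "int ?m = (x * d) mod int p ^ n" using p by (simp add: prime_gt_0_nat)
  then have "[int ?m * t = (x * d) * t] (mod int p ^ n)" by (simp add: cong_def mod_simps)
  also have "(x * d) * t = int p ^ (n - 1) + int p ^ n * (- y * d)"
    unfolding d xy[symmetric] by (simp add: algebra_simps)
  also have "[int p ^ (n - 1) + int p ^ n * (- y * d) = int p ^ (n - 1)] (mod int p ^ n)"
    by (simp add: cong_iff_dvd_diff)
  finally show thesis by (rule that)
qed

section \<open>Block-fixing and affine automorphisms modulo a prime power\<close>

context sidon_set
begin

text \<open>
  Otherwise \<open>\<psi>\<close> permutes the base line and shifts its elements by pairwise different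
  members of one coset of the subgroup of order \<open>p\<close>; as these shifts add up to zero, the
  line has exactly \<open>p\<close> points, hence \<open>p\<close> is odd, and then the sum of the whole coset is
  not zero.
\<close>

lemma line_block_fixed:
  assumes v: "v = e * int p" and p: "prime p" and e: "e = int p ^ m"
    and u: "u \<in> carrier A" and fix_blocks: "\<And>x. [fst u x = x] (mod e)"
  shows "[snd u y = y] (mod e)"
proof (rule ccontr)
  assume neg: "\<not> [snd u y = y] (mod e)"
  define c where "c = snd u y - y"
  define K where "K = S \<inter> {0..<v}"
  define a where "a s = (fst u (s + y) - (s + y)) div e" for s
  define \<psi> where "\<psi> s = (fst u (s + y) - snd u y) mod v" for s
  have c: "\<not> e dvd c" using neg unfolding c_def by (simp add: cong_iff_dvd_diff)
  have e0: "e > 0" using e p by (simp add: prime_gt_0_nat)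
  have a: "e * a s = fst u (s + y) - (s + y)" for s
    using fix_blocks[of "s + y"] unfolding a_def by (simp add: cong_iff_dvd_diff)
  have \<psi>_cong: "[\<psi> s = s - c + e * a s] (mod v)" for s
    unfolding \<psi>_def a c_def by (simp add: cong_def)
  have finK: "finite K" unfolding K_def by simp
  have \<psi>K: "\<psi> s \<in> K" if "s \<in> K" for s
  proof -
    have "fst u (s + y) - snd u y \<in> S" using that A_inc[OF u] unfolding K_def by simp
    moreover have "[fst u (s + y) - snd u y = \<psi> s] (mod v)" unfolding \<psi>_def by (simp add: cong_def)
    ultimately have "\<psi> s \<in> S" using periodic_setD[OF periodic] by blast
    then show ?thesis unfolding K_def \<psi>_def using v_pos by simp
  qed
  have \<psi>_inj_cong: "[s = t] (mod v)" if "\<psi> s = \<psi> t" for s t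
  proof -
    have "[fst u (s + y) - snd u y = fst u (t + y) - snd u y] (mod v)"
      using that unfolding \<psi>_def cong_def .
    then have "[fst u (s + y) - snd u y + snd u y = fst u (t + y) - snd u y + snd u y] (mod v)"
      by (intro cong_add) auto
    then have "[s + y = t + y] (mod v)"
      using zperm_cong_iff[OF A_zperm(1)[OF u]] by simp
    then show ?thesis by (simp add: cong_add_rcancel)
  qed
  have K_eqI: "s = t" if "s \<in> K" "t \<in> K" "[s = t] (mod v)" for s t
    using that unfolding K_def by (simp add: cong_def)
  have "inj_on \<psi> K" by (rule inj_onI) (use \<psi>_inj_cong K_eqI in blast)
  moreover have "\<psi> ` K \<subseteq> K" using \<psi>K by blast
  ultimately have "bij_betw \<psi> K K" using finK by (simp add: bij_betw_def endo_inj_surj)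
  then have "(\<Sum>s\<in>K. \<psi> s) = (\<Sum>s\<in>K. s)" by (rule sum.reindex_bij_betw)
  moreover have "[(\<Sum>s\<in>K. \<psi> s) = (\<Sum>s\<in>K. s - c + e * a s)] (mod v)"
    by (rule cong_sum) (rule \<psi>_cong)
  ultimately have "v dvd (\<Sum>s\<in>K. s) - (\<Sum>s\<in>K. s - c + e * a s)"
    by (simp add: cong_iff_dvd_diff)
  then have kc: "v dvd int (card K) * c - e * (\<Sum>s\<in>K. a s)"
    by (simp add: sum.distrib sum_subtractf sum_distrib_left)
  have inj: "inj_on (\<lambda>s. a s mod int p) K"
  proof (rule inj_onI)
    \<comment> \<open>Equal residues of \<open>a\<close> give \<open>s\<close> and \<open>t\<close>
      equal shifts under \<open>\<psi>\<close>. The Sidon property leaves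
      \<open>\<psi> s = s\<close>, impossible as \<open>e\<close> does not divide \<open>c\<close>,
      or \<open>\<psi> s = \<psi> t\<close>.\<close>
    fix s t assume s: "s \<in> K" and t: "t \<in> K" and eq: "a s mod int p = a t mod int p"
    have "v dvd e * a s - e * a t"
      using eq unfolding v right_diff_distrib[symmetric]
      by (intro mult_dvd_mono) (simp_all add: mod_eq_dvd_iff)
    then have "v dvd ((\<psi> s - (s - c + e * a s)) - (\<psi> t - (t - c + e * a t))) + (e * a s - e * a t)"
      using \<psi>_cong[of s] \<psi>_cong[of t] unfolding cong_iff_dvd_diff by (meson dvd_add dvd_diff)
    then have "[\<psi> s - s = \<psi> t - t] (mod v)"
      unfolding cong_iff_dvd_diff by (simp add: algebra_simps)
    then have "[\<psi> s = s] (mod v) \<or> [\<psi> s = \<psi> t] (mod v)"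
      using sidon[of "\<psi> s" s "\<psi> t" t] \<psi>K s t unfolding K_def by blast
    moreover have "\<not> [\<psi> s = s] (mod v)"
    proof
      assume "[\<psi> s = s] (mod v)"
      then have "v dvd (\<psi> s - s) - (\<psi> s - (s - c + e * a s))"
        using \<psi>_cong[of s] unfolding cong_iff_dvd_diff by (rule dvd_diff)
      then have "e dvd e * a s - c" unfolding v by (auto elim: dvd_mult_left)
      then show False using c by (simp add: dvd_diff_right_iff)
    qed
    ultimately have "\<psi> s = \<psi> t" using K_eqI \<psi>K s t by blast
    then show "s = t" using \<psi>_inj_cong K_eqI s t by blast
  qed
  have sub: "(\<lambda>s. a s mod int p) ` K \<subseteq> {0..<int p}" using p prime_gt_0_nat by auto
  have k_le: "card K \<le> p" using card_inj_on_le[OF inj sub] by simp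
  have k3: "card K \<ge> 3" unfolding K_def by (rule card_ge_3)
  have "e dvd int (card K) * c - e * (\<Sum>s\<in>K. a s)" using kc v by (auto elim: dvd_mult_left)
  then have ekc: "e dvd int (card K) * c" by (simp add: dvd_diff_left_iff)
  \<comment> \<open>Otherwise \<open>card K\<close> would be invertible modulo \<open>e\<close>, and
    \<open>ekc\<close> would make \<open>c\<close> a multiple of \<open>e\<close>.\<close>
  have "int p dvd int (card K)"
  proof (rule ccontr)
    assume "\<not> int p dvd int (card K)"
    then have "coprime (int p) (int (card K))" using p by (simp add: prime_imp_coprime)
    then have "coprime e (int (card K))" unfolding e by simp
    then show False using ekc c by (simp add: coprime_dvd_mult_right_iff)
  qed
  then have kp: "card K = p" using k_le k3 by (simp add: dvd_imp_le le_antisym)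
  have "(\<lambda>s. a s mod int p) ` K = {0..<int p}"
    using inj sub kp by (intro card_subset_eq) (auto simp: card_image)
  then have "(\<Sum>s\<in>K. a s mod int p) = (\<Sum>i\<in>{0..<int p}. i)"
    using inj by (metis (no_types, lifting) sum.reindex_cong)
  moreover have "int p dvd (\<Sum>i\<in>{0..<int p}. i)"
  proof -
    have "odd p" using p kp k3 prime_odd_nat by simp
    then obtain h where h: "p = 2 * h + 1" by (rule oddE)
    have "(\<Sum>i\<in>{0..<int (2 * h + 1)}. i) = int (2 * h + 1) * int h"
    proof (induction h)
      case (Suc h)
      have "{0..<int (2 * Suc h + 1)} = insert (int (2 * h + 2)) (insert (int (2 * h + 1)) {0..<int (2 * h + 1)})"
        by auto
      then show ?case using Suc by (simp add: algebra_simps)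
    next
      case 0
      have "{0..<1::int} = {0}" by auto
      then show ?case by simp
    qed
    then show ?thesis using h by simp
  qed
  moreover have "[(\<Sum>s\<in>K. a s mod int p) = (\<Sum>s\<in>K. a s)] (mod int p)"
    by (rule cong_sum) (simp add: cong_def)
  ultimately have "int p dvd (\<Sum>s\<in>K. a s)" by (simp add: cong_dvd_iff)
  then have "v dvd e * (\<Sum>s\<in>K. a s)" unfolding v by (intro mult_dvd_mono) auto
  then have "v dvd int p * c" using kc kp by (simp add: dvd_diff_left_iff)
  then have "e dvd c" using p unfolding v by (simp add: mult.commute prime_gt_0_nat)
  then show False using c by simp
qed

text \<open>
  An affine map \<open>x \<mapsto> a x + b\<close> with \<open>a\<close> congruent to 3 modulo 4 is not a
  cycle of length \<open>2\<^sup>n\<close>, although for \<open>p = 2\<close> it can lie in \<open>P\<close>.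
\<close>

lemma affine_square_tower:
  assumes u: "u \<in> carrier A" "\<And>x. [fst u x = a * x + b] (mod v)" and a: "[a = 3] (mod 4)"
  shows "\<exists>c d. (\<forall>x. [fst (u [^]\<^bsub>A\<^esub> (2 ^ Suc j :: nat)) x = c * x + d] (mod v)) \<and>
    2 ^ (j + 2) dvd c - 1 \<and> 2 ^ (j + 2) dvd d"
proof (induction j)
  case 0
  have 4: "4 dvd a + 1" using a unfolding cong_def by presburger
  have "fst (u [^]\<^bsub>A\<^esub> (2 ^ Suc 0 :: nat)) x = fst u (fst u x)" for x
    using u(1) by (simp add: numeral_2_eq_2)
  moreover have "[fst u (fst u x) = a * a * x + (a + 1) * b] (mod v)" for x
  proof -
    have "[fst u (fst u x) = a * fst u x + b] (mod v)" by (rule u(2))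
    also have "[a * fst u x + b = a * (a * x + b) + b] (mod v)"
      by (intro cong_add cong_mult u(2)) auto
    finally show ?thesis by (simp add: algebra_simps)
  qed
  moreover have "4 dvd a * a - 1"
  proof -
    have "a * a - 1 = (a + 1) * (a - 1)" by (simp add: algebra_simps)
    then show ?thesis using 4 by simp
  qed
  ultimately show ?case using 4 by (intro exI[of _ "a * a"] exI[of _ "(a + 1) * b"]) auto
next
  case (Suc j)
  then obtain c d where cd: "\<And>x. [fst (u [^]\<^bsub>A\<^esub> (2 ^ Suc j :: nat)) x = c * x + d] (mod v)"
    "2 ^ (j + 2) dvd c - 1" "2 ^ (j + 2) dvd d" by blast
  let ?w = "u [^]\<^bsub>A\<^esub> (2 ^ Suc j :: nat)"
  have "u [^]\<^bsub>A\<^esub> (2 ^ Suc (Suc j) :: nat) = ?w \<otimes>\<^bsub>A\<^esub> ?w"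
    using u(1) by (simp add: nat_pow_mult)
  then have "fst (u [^]\<^bsub>A\<^esub> (2 ^ Suc (Suc j) :: nat)) x = fst ?w (fst ?w x)" for x by simp
  moreover have "[fst ?w (fst ?w x) = c * c * x + (c + 1) * d] (mod v)" for x
  proof -
    have "[fst ?w (fst ?w x) = c * fst ?w x + d] (mod v)" by (rule cd)
    also have "[c * fst ?w x + d = c * (c * x + d) + d] (mod v)"
      by (intro cong_add cong_mult cd) auto
    finally show ?thesis by (simp add: algebra_simps)
  qed
  \<comment> \<open>Since \<open>c + 1\<close> is even, each squaring gains a factor 2 in both
    \<open>c - 1\<close> and \<open>d\<close>.\<close>
  moreover have even: "2 dvd c + 1"
  proof -
    have "2 dvd c - 1" using cd(2) by (rule dvd_trans[rotated]) simp
    then show ?thesis by presburger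
  qed
  have "2 * 2 ^ (j + 2) dvd (c + 1) * (c - 1)" "2 * 2 ^ (j + 2) dvd (c + 1) * d"
    using mult_dvd_mono[OF even cd(2)] mult_dvd_mono[OF even cd(3)] by blast+
  then have "2 ^ (Suc j + 2) dvd c * c - 1" "2 ^ (Suc j + 2) dvd (c + 1) * d"
    by (simp_all add: algebra_simps)
  ultimately show ?case by (intro exI[of _ "c * c"] exI[of _ "(c + 1) * d"]) auto
qed

end

section \<open>Conjugation into the translations for prime powers\<close>

context connected_sidon_set
begin

text \<open>Some power of \<open>u\<close> is multiplication by a number \<open>b\<close> other than
  1 with \<open>b ^ p\<close> equal to 1. Then \<open>b\<close> is 1 modulo
  \<open>p ^ (n - 1)\<close>, so this power fixes the classes of points and, by
  \<open>line_block_fixed\<close>, those of lines. It is therefore a translation, yet it fixes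
  0.\<close>

lemma linear_p_element_trivial:
  assumes v: "v = int p ^ n" and p: "prime p" and n: "n \<ge> 1"
    and u: "u \<in> carrier A" "\<And>x. [fst u x = a * x] (mod v)" "u [^]\<^bsub>A\<^esub> (p ^ k :: nat) = \<one>\<^bsub>A\<^esub>"
    and comm: "u \<otimes>\<^bsub>A\<^esub> transl v (int p ^ (n - 1)) = transl v (int p ^ (n - 1)) \<otimes>\<^bsub>A\<^esub> u"
    and two: "p = 2 \<Longrightarrow> [a = 1] (mod 4)"
  shows "[a = 1] (mod v)"
proof (rule ccontr)
  assume neg: "\<not> [a = 1] (mod v)"
  have pow: "[fst (u [^]\<^bsub>A\<^esub> i) x = a ^ i * x] (mod v)" for i :: nat and x
  proof (induction i arbitrary: x)
    case (Suc i)
    have "fst (u [^]\<^bsub>A\<^esub> Suc i) x = fst (u [^]\<^bsub>A\<^esub> i) (fst u x)" by simp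
    also have "[fst (u [^]\<^bsub>A\<^esub> i) (fst u x) = a ^ i * fst u x] (mod v)" by (rule Suc)
    also have "[a ^ i * fst u x = a ^ i * (a * x)] (mod v)" by (intro cong_mult u(2)) auto
    finally show ?case by (simp add: algebra_simps)
  qed (simp add: cong_def)
  have ex: "[a ^ (p ^ k) = 1] (mod v)"
    using pow[of "p ^ k" 1] u(3) by (simp add: cong_def)
  \<comment> \<open>By minimality \<open>b\<close>, taken one step before the exponent
    \<open>m\<close>, is not 1, while its \<open>p\<close>-th power is.\<close>
  define m where "m = (LEAST m. [a ^ (p ^ m) = 1] (mod v))"
  have m: "[a ^ (p ^ m) = 1] (mod v)" unfolding m_def using ex by (rule LeastI)
  have "m \<noteq> 0" using m neg by (metis power_0 power_one_right)
  then obtain j where j: "m = Suc j" using not0_implies_Suc by blast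
  define b where "b = a ^ (p ^ j)"
  have nb: "\<not> [b = 1] (mod v)" unfolding b_def using j m_def not_less_Least[of j] by (metis lessI)
  have "b ^ p = a ^ (p ^ m)" unfolding b_def j by (simp add: power_mult[symmetric] mult.commute)
  then have bp: "[b ^ p = 1] (mod int p ^ n)" using m v by simp
  have "[b = 1] (mod 4)" if "p = 2"
    unfolding b_def using cong_pow[OF two[OF that], of "p ^ j"] by simp
  then have be: "[b = 1] (mod int p ^ (n - 1))"
    by (rule cong_one_if_pth_power_cong_one[OF p n bp])
  let ?w = "u [^]\<^bsub>A\<^esub> (p ^ j)"
  have w: "?w \<in> carrier A" using u(1) by simp
  have wb: "[fst ?w x = b * x] (mod v)" for x using pow[of "p ^ j" x] unfolding b_def .
  have ev: "v = int p ^ (n - 1) * int p" using power_minus_mult[of n "int p"] n v by simp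
  have fixb: "[fst ?w x = x] (mod int p ^ (n - 1))" for x
  proof -
    have "[fst ?w x = b * x] (mod int p ^ (n - 1))" using wb ev by (metis cong_dvd_modulus dvd_triv_left)
    also have "[b * x = 1 * x] (mod int p ^ (n - 1))" using be by (intro cong_mult) auto
    finally show ?thesis by simp
  qed
  have wcomm: "?w \<otimes>\<^bsub>A\<^esub> transl v (int p ^ (n - 1)) = transl v (int p ^ (n - 1)) \<otimes>\<^bsub>A\<^esub> ?w"
    using comm u(1) by (intro group_commutes_pow) auto
  have "[snd ?w y = y] (mod int p ^ (n - 1))" for y
    by (rule line_block_fixed[OF ev p refl w fixb])
  then obtain t where t: "?w = transl v t"
    using block_translation_is_transl[OF w fixb _ commute_transl_cong(1)[OF w wcomm]] by blast
  have "[t = 0] (mod v)" using wb[of 0] unfolding t by (simp add: cong_def)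
  then have "[fst ?w 1 = 1] (mod v)" unfolding t by (simp add: cong_def mod_add_right_eq[symmetric])
  then show False using nb wb[of 1] by (simp add: cong_def)
qed

text \<open>The assumptions give \<open>w\<close> the exact order \<open>p ^ n\<close>. A Sylow
  \<open>p\<close>-subgroup \<open>P\<close> containing the translations turns out to consist of
  affine maps, and an affine member of \<open>P\<close> of order \<open>p ^ n\<close> is a
  translation.\<close>

lemma conj_into_translations_prime_power:
  assumes v: "v = int p ^ n" and p: "prime p" and n: "n \<ge> 1"
    and w: "w \<in> carrier A" "w [^]\<^bsub>A\<^esub> (p ^ n) = \<one>\<^bsub>A\<^esub>" "w [^]\<^bsub>A\<^esub> (p ^ (n - 1)) \<noteq> \<one>\<^bsub>A\<^esub>"
  obtains g t where "g \<in> carrier A" "g \<otimes>\<^bsub>A\<^esub> w \<otimes>\<^bsub>A\<^esub> inv\<^bsub>A\<^esub> g = transl v t"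
proof -
  let ?e = "int p ^ (n - 1)"
  have ev: "v = ?e * int p" using power_minus_mult[of n "int p"] n v by simp
  have v3: "v \<ge> 3"
    using card_ge_3 card_mono[of "{0..<v}" "S \<inter> {0..<v}"] by simp
  have ne: "\<not> v dvd ?e" using p unfolding ev by (auto simp: dvd_mult_cancel_left prime_gt_0_nat not_prime_1) 
  have "transl v 1 [^]\<^bsub>A\<^esub> (p ^ n) = \<one>\<^bsub>A\<^esub>"
    by (simp add: transl_pow transl_eq_one_iff) (simp add: v)
  then obtain P k where P: "subgroup P A" "card P = p ^ k" "transl v 1 \<in> P"
    and Pc: "\<And>u j. \<lbrakk>u \<in> carrier A; u [^]\<^bsub>A\<^esub> (p ^ j :: nat) = \<one>\<^bsub>A\<^esub>\<rbrakk> \<Longrightarrow> \<exists>x\<in>carrier A. x \<otimes>\<^bsub>A\<^esub> u \<otimes>\<^bsub>A\<^esub> inv\<^bsub>A\<^esub> x \<in> P"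
    using sylow_containing[OF fin_A p, of "transl v 1" n] by (metis transl_closed)
  note Pm = subgroup.mem_carrier[OF P(1)]
  obtain g where g: "g \<in> carrier A" "g \<otimes>\<^bsub>A\<^esub> w \<otimes>\<^bsub>A\<^esub> inv\<^bsub>A\<^esub> g \<in> P" using Pc[OF w(1,2)] by blast
  let ?GP = "A\<lparr>carrier := P\<rparr>"
  interpret GP: group ?GP by (rule subgroup_imp_group[OF P(1)])
  have ord: "order ?GP = p ^ k" using P(2) by (simp add: order_def)
  have translP: "transl v t \<in> P" for t
  proof -
    have "transl v t = transl v 1 [^]\<^bsub>A\<^esub> nat (t mod v)"
      using v_pos by (simp add: transl_pow transl_eq_iff)
    then show ?thesis using GP.nat_pow_closed[of "transl v 1"] P(3) by (simp add: nat_pow_consistent[symmetric])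
  qed
  have "transl v 1 \<noteq> \<one>\<^bsub>A\<^esub>" using v3 by (simp add: transl_eq_one_iff zdvd_not_zless)
  then have "k \<noteq> 0"
    using P subgroup.one_closed[OF P(1)] by (metis card_1_singletonE power_0 singletonD)
  then obtain z where z: "z \<in> P" "z \<noteq> \<one>\<^bsub>A\<^esub>" "\<And>g. g \<in> P \<Longrightarrow> g \<otimes>\<^bsub>A\<^esub> z = z \<otimes>\<^bsub>A\<^esub> g"
    using GP.p_group_center_nontrivial[OF ord p] by auto
  have "z \<otimes>\<^bsub>A\<^esub> transl v 1 = transl v 1 \<otimes>\<^bsub>A\<^esub> z" using z(3)[OF P(3)] by simp
  from commute_transl_cong(1)[OF Pm[OF z(1)] this]
  obtain t where t: "z = transl v t"
    \<comment> \<open>With \<open>e = 1\<close> the conditions on classes are void, so commuting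
      with the translation by 1 is enough.\<close>
    using block_translation_is_transl[OF Pm[OF z(1)], of 1] by auto
  have "\<not> int p ^ n dvd t" using z(2) unfolding t v[symmetric] by (simp add: transl_eq_one_iff)
  then obtain m :: nat where "[int m * t = ?e] (mod int p ^ n)"
    by (rule multiple_cong_prime_power[OF p n])
  then have eta: "transl v ?e = z [^]\<^bsub>A\<^esub> m"
    unfolding t by (simp add: transl_pow transl_eq_iff v[symmetric] cong_sym)
  have comm: "u \<otimes>\<^bsub>A\<^esub> transl v ?e = transl v ?e \<otimes>\<^bsub>A\<^esub> u" if "u \<in> P" for u
    unfolding eta using z(3)[OF that] Pm[OF that] Pm[OF z(1)] group_commutes_pow[of z u m] by simp
  \<comment> \<open>\<open>N\<close> collects the affine members of \<open>P\<close>. Should it be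
    smaller than \<open>P\<close>, its normaliser in \<open>P\<close> would contain a further
    element, which is then shown to be affine as well.\<close>
  define N where "N = {u \<in> P. \<exists>a b. \<forall>x. [fst u x = a * x + b] (mod v)}"
  have NI: "u \<in> N" if "u \<in> P" "\<And>x. [fst u x = a * x + b] (mod v)" for u a b
    unfolding N_def using that by blast
  have N: "subgroup N ?GP"
  proof (rule GP.subgroupI)
    show "N \<subseteq> carrier ?GP" unfolding N_def by auto
    have "transl v 1 \<in> N" by (rule NI[of _ 1 1]) (use P(3) in \<open>auto simp: cong_def\<close>)
    then show "N \<noteq> {}" by blast
  next
    fix u assume "u \<in> N"
    then obtain a b where u: "u \<in> P" "\<And>x. [fst u x = a * x + b] (mod v)" unfolding N_def by blast
    have uc: "u \<in> carrier A" by (rule Pm[OF u(1)])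
    \<comment> \<open>The point sent to \<open>1 + b\<close> inverts the slope \<open>a\<close>
      modulo \<open>v\<close>.\<close>
    obtain y where y: "fst u y = (1 + b) mod v" by (rule zperm_surj[OF A_zperm(1)[OF uc] v_pos])
    have "[a * y + b = 1 + b] (mod v)" using u(2)[of y] y by (simp add: cong_def)
    then have ay: "[a * y = 1] (mod v)" by (simp add: cong_add_rcancel)
    have iP: "inv\<^bsub>A\<^esub> u \<in> P" using P(1) u(1) by (rule subgroup.m_inv_closed)
    have "[fst (inv\<^bsub>A\<^esub> u) x = y * x + (- (y * b))] (mod v)" for x
    proof -
      let ?z = "fst (inv\<^bsub>A\<^esub> u) x"
      have "fst (u \<otimes>\<^bsub>A\<^esub> inv\<^bsub>A\<^esub> u) x = x mod v" using uc by simp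
      then have "fst u ?z = x mod v" by (simp only: aut_group_sel comp_apply)
      then have "[a * ?z + b = x] (mod v)" using u(2)[of ?z] by (simp add: cong_def)
      then have "[y * (a * ?z + b) = y * x] (mod v)" by (intro cong_mult) auto
      then have "[y * (a * ?z + b) - y * b = y * x - y * b] (mod v)" by (intro cong_diff) auto
      moreover have "[a * y * ?z = 1 * ?z] (mod v)" using ay by (intro cong_mult) auto
      ultimately show ?thesis by (simp add: algebra_simps) (metis cong_sym cong_trans)
    qed
    then have "inv\<^bsub>A\<^esub> u \<in> N" by (rule NI[OF iP])
    then show "inv\<^bsub>?GP\<^esub> u \<in> N" using m_inv_consistent[OF P(1) u(1)] by simp
  next
    fix u u' assume "u \<in> N" "u' \<in> N"
    then obtain a b a' b' where u: "u \<in> P" "\<And>x. [fst u x = a * x + b] (mod v)"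
      "u' \<in> P" "\<And>x. [fst u' x = a' * x + b'] (mod v)" unfolding N_def by blast
    have "[fst (u \<otimes>\<^bsub>A\<^esub> u') x = (a * a') * x + (a * b' + b)] (mod v)" for x
    proof -
      have "[fst u (fst u' x) = a * fst u' x + b] (mod v)" by (rule u(2))
      also have "[a * fst u' x + b = a * (a' * x + b') + b] (mod v)"
        by (intro cong_add cong_mult u(4)) auto
      finally show ?thesis by (simp add: algebra_simps)
    qed
    then have "u \<otimes>\<^bsub>A\<^esub> u' \<in> N" by (intro NI[OF subgroup.m_closed[OF P(1) u(1,3)]])
    then show "u \<otimes>\<^bsub>?GP\<^esub> u' \<in> N" by simp
  qed
  have N_transl: "\<exists>t. u = transl v t" if u: "u \<in> N" "u [^]\<^bsub>A\<^esub> (p ^ (n - 1)) \<noteq> \<one>\<^bsub>A\<^esub>" for u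
  proof -
    obtain a b where uP: "u \<in> P" and ab: "\<And>x. [fst u x = a * x + b] (mod v)"
      using u(1) unfolding N_def by blast
    have uc: "u \<in> carrier A" by (rule Pm[OF uP])
    \<comment> \<open>Removing the constant term leaves the linear part, which is still in
      \<open>P\<close> and so has \<open>p\<close>-power order.\<close>
    let ?L = "transl v (- b) \<otimes>\<^bsub>A\<^esub> u"
    have LP: "?L \<in> P" by (rule subgroup.m_closed[OF P(1) translP uP])
    have L: "[fst ?L x = a * x] (mod v)" for x
      using cong_diff[OF ab[of x] cong_refl[of b]] by (simp add: cong_def)
    have Lk: "?L [^]\<^bsub>A\<^esub> (p ^ k) = \<one>\<^bsub>A\<^esub>"
      using GP.pow_order_eq_1[of ?L] LP ord by (simp add: nat_pow_consistent[symmetric])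
    \<comment> \<open>A slope congruent to 3 modulo 4 would make the power of \<open>u\<close> with
      exponent \<open>2 ^ (n - 1)\<close> trivial, against the assumption on its order.\<close>
    have "[a = 1] (mod 4)" if p2: "p = 2"
    proof (rule ccontr)
      assume neg: "\<not> [a = 1] (mod 4)"
      have n2: "n \<ge> 2" using v3 v p2 n by (cases "n = 1") auto
      have "odd a"
      proof
        assume "even a"
        have "\<exists>y. [a * y = 1] (mod v)"
        proof -
          obtain y where y: "fst ?L y = 1 mod v" by (rule zperm_surj[OF A_zperm(1)[OF Pm[OF LP]] v_pos])
          then show ?thesis using L[of y] by (intro exI[of _ y]) (simp add: cong_def)
        qed
        then obtain y where "[a * y = 1] (mod v)" by blast
        moreover have "even v" using v p2 n by simp
        ultimately have "[a * y = 1] (mod 2)" by (rule cong_dvd_modulus)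
        then have "odd (a * y)" unfolding odd_iff_mod_2_eq_one cong_def by simp
        then show False using \<open>even a\<close> by simp
      qed
      then have "[a = 3] (mod 4)" using neg unfolding cong_def by presburger
      then obtain c d where cd: "\<And>x. [fst (u [^]\<^bsub>A\<^esub> (2 ^ Suc (n - 2) :: nat)) x = c * x + d] (mod v)"
        "2 ^ (n - 2 + 2) dvd c - 1" "2 ^ (n - 2 + 2) dvd d"
        using affine_square_tower[OF uc ab] by blast
      have "n - 2 + 2 = n" using n2 by simp
      then have vn: "2 ^ (n - 2 + 2) = v" using v p2 by simp
      have sn: "Suc (n - 2) = n - 1" using n2 by simp
      have "u [^]\<^bsub>A\<^esub> (p ^ (n - 1)) = transl v 0"
      proof (rule transl_if_fst)
        fix x
        have "[c * x + d = 1 * x + 0] (mod v)"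
          using cd(2,3) unfolding vn by (intro cong_add cong_mult) (simp_all add: cong_iff_dvd_diff)
        then show "[fst (u [^]\<^bsub>A\<^esub> (p ^ (n - 1))) x = x + 0] (mod v)"
          using cd(1)[of x] cong_trans unfolding sn p2 by fastforce
      qed (use uc in simp)
      then show False using u(2) by (simp add: transl_zero)
    qed
    then have "[a = 1] (mod v)"
      by (rule linear_p_element_trivial[OF v p n Pm[OF LP] L Lk comm[OF LP]])
    then have "[fst u x = x + b] (mod v)" for x
      using cong_trans[OF ab[of x] cong_add[OF cong_mult[of a 1 v x x] cong_refl]] by simp
    then show ?thesis using transl_if_fst[OF uc] by blast
  qed
  have "N = P"
  proof (rule ccontr)
    assume "N \<noteq> P"
    then obtain x where x: "x \<in> P" "x \<notin> N" "\<And>u. u \<in> N \<Longrightarrow> x \<otimes>\<^bsub>A\<^esub> u \<otimes>\<^bsub>A\<^esub> inv\<^bsub>A\<^esub> x \<in> N"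
      using GP.normalizer_grows[OF ord p N] m_inv_consistent[OF P(1)] by auto
    have xc: "x \<in> carrier A" by (rule Pm[OF x(1)])
    have "transl v 1 \<in> N" by (rule NI[of _ 1 1]) (use P(3) in \<open>auto simp: cong_def\<close>)
    then have yN: "x \<otimes>\<^bsub>A\<^esub> transl v 1 \<otimes>\<^bsub>A\<^esub> inv\<^bsub>A\<^esub> x \<in> N" by (rule x(3))
    have "transl v 1 [^]\<^bsub>A\<^esub> (p ^ (n - 1)) \<noteq> \<one>\<^bsub>A\<^esub>"
      using ne by (simp add: transl_pow transl_eq_one_iff)
    then have "(x \<otimes>\<^bsub>A\<^esub> transl v 1 \<otimes>\<^bsub>A\<^esub> inv\<^bsub>A\<^esub> x) [^]\<^bsub>A\<^esub> (p ^ (n - 1)) \<noteq> \<one>\<^bsub>A\<^esub>"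
      using xc conj_pow[OF xc transl_closed] conj_eq_one[OF xc] by (metis nat_pow_closed transl_closed)
    then obtain s where s: "x \<otimes>\<^bsub>A\<^esub> transl v 1 \<otimes>\<^bsub>A\<^esub> inv\<^bsub>A\<^esub> x = transl v s" using N_transl[OF yN] by blast
    then have "x \<otimes>\<^bsub>A\<^esub> transl v 1 = transl v s \<otimes>\<^bsub>A\<^esub> x"
      using xc by (metis inv_solve_right' m_closed transl_closed)
    then have "fst (x \<otimes>\<^bsub>A\<^esub> transl v 1) y = fst (transl v s \<otimes>\<^bsub>A\<^esub> x) y" for y by simp
    \<comment> \<open>Conjugating the translation by 1 into a translation by \<open>s\<close> makes
      \<open>x\<close> affine with slope \<open>s\<close>.\<close>
    then have step: "[fst x (y + 1) = fst x y + s] (mod v)" for y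
      using A_zperm(1)[OF xc] by (simp add: cong_def)
    have "[fst x y = s * y + fst x 0] (mod v)" for y
      using shift_multiple[where f = "fst x" and e = 1 and t = s and x = 0 and m = y, OF step]
      by (simp add: algebra_simps)
    then have "x \<in> N" by (rule NI[OF x(1)])
    then show False using x(2) by simp
  qed
  then have "g \<otimes>\<^bsub>A\<^esub> w \<otimes>\<^bsub>A\<^esub> inv\<^bsub>A\<^esub> g \<in> N" using g(2) by simp
  moreover have "(g \<otimes>\<^bsub>A\<^esub> w \<otimes>\<^bsub>A\<^esub> inv\<^bsub>A\<^esub> g) [^]\<^bsub>A\<^esub> (p ^ (n - 1)) \<noteq> \<one>\<^bsub>A\<^esub>"
    using conj_pow[OF g(1) w(1)] conj_eq_one[OF g(1)] w by (metis nat_pow_closed)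
  ultimately show thesis using that[OF g(1)] N_transl by blast
qed

end

section \<open>Isomorphisms are affine up to automorphisms\<close>

lemma inc_iso_transl:
  assumes "v > 0" "periodic_set v T"
  shows "transl v t \<in> inc_iso v T T"
  unfolding transl_def using assms
  by (intro inc_isoI shift_zperm) (simp_all add: periodic_set_mod_diff)

text \<open>Pulling the translations back along \<open>h\<close> gives a second regular cyclic
  subgroup, generated by \<open>w\<close>. If \<open>g\<close> conjugates \<open>w\<close> to a
  translation, then \<open>h\<close> composed with the inverse of \<open>g\<close> carries
  translations to translations and is affine.\<close>

lemma (in connected_sidon_set) iso_imp_affine:
  assumes T: "periodic_set v T" and h: "h \<in> inc_iso v S T"
    and cases: "(\<exists>p q :: nat. prime p \<and> prime q \<and> v = int p * int q) \<or>
      (\<exists>p n :: nat. prime p \<and> n \<ge> 1 \<and> v = int p ^ n)"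
  shows "\<exists>a b. coprime a v \<and> (\<forall>x. x \<in> S \<longleftrightarrow> a * x + b \<in> T)"
proof -
  obtain h' where h': "h' \<in> inc_iso v T S"
    "\<And>x. fst h' (fst h x) = x mod v" "\<And>x. fst h (fst h' x) = x mod v"
    "\<And>x. snd h' (snd h x) = x mod v" "\<And>x. snd h (snd h' x) = x mod v"
    using inc_iso_inverse[OF h v_pos T] by metis
  note hz = inc_isoD(1,2)[OF h] and hz' = inc_isoD(1,2)[OF h'(1)]
  define W where
    "W t = (fst h' \<circ> fst (transl v t) \<circ> fst h, snd h' \<circ> snd (transl v t) \<circ> snd h)" for t
  have W: "W t \<in> carrier A" for t
    using inc_iso_comp[OF inc_iso_comp[OF h inc_iso_transl[OF v_pos T, of t]] h'(1)]
    by (simp add: carrier_aut_group comp_assoc W_def)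
  have W_mult: "W s \<otimes>\<^bsub>A\<^esub> W t = W (s + t)" for s t
    unfolding W_def using hz hz' by (simp add: prod_eq_iff fun_eq_iff h' mod_simps ac_simps)
  have W_zero: "W 0 = \<one>\<^bsub>A\<^esub>"
    unfolding W_def using hz hz' by (simp add: prod_eq_iff fun_eq_iff h')
  define w where "w = W 1"
  have w: "w \<in> carrier A" unfolding w_def by (rule W)
  have w_pow: "w [^]\<^bsub>A\<^esub> n = W (int n)" for n :: nat
    by (induction n) (simp_all add: W_zero w_def W_mult add.commute)
  have w_one: "w [^]\<^bsub>A\<^esub> n = \<one>\<^bsub>A\<^esub> \<longleftrightarrow> v dvd int n" for n :: nat
  proof
    assume "w [^]\<^bsub>A\<^esub> n = \<one>\<^bsub>A\<^esub>"
    then have "fst (W (int n)) 0 = fst \<one>\<^bsub>A\<^esub> 0" using w_pow by simp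
    then have "fst h' ((fst h 0 + int n) mod v) = fst h' (fst h 0)" using h'(2)[of 0] by (simp add: W_def)
    then have "[fst h 0 + int n = fst h 0] (mod v)"
      using zperm_eq_iff[OF hz'(1)] by (simp add: cong_def)
    then show "v dvd int n" by (simp add: cong_iff_dvd_diff)
  next
    assume "v dvd int n"
    then have "transl v (int n) = transl v 0" by (simp add: transl_eq_iff cong_0_iff)
    then show "w [^]\<^bsub>A\<^esub> n = \<one>\<^bsub>A\<^esub>" unfolding w_pow W_zero[symmetric] by (simp add: W_def)
  qed
  have "\<exists>g\<in>carrier A. \<exists>t. g \<otimes>\<^bsub>A\<^esub> w \<otimes>\<^bsub>A\<^esub> inv\<^bsub>A\<^esub> g = transl v t"
  proof -
    have pp: ?thesis if p: "prime p" "n \<ge> 1" "v = int p ^ n" for p n :: nat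
    proof -
      have "v = int p ^ (n - 1) * int p" using power_minus_mult[of n "int p"] p by simp
      moreover have "int p > 1" using p prime_gt_1_nat by simp
      ultimately have "int p ^ (n - 1) < v" using v_pos
        by (metis mult.right_neutral mult_less_cancel_left_pos zero_less_mult_pos2 zero_less_one order.strict_trans)
      then have "\<not> v dvd int (p ^ (n - 1))"
        using \<open>int p > 1\<close> by (intro zdvd_not_zless) auto
      then show ?thesis
        using conj_into_translations_prime_power[OF p(3,1,2) w] w_one p(3) by (metis dvd_refl of_nat_power)
    qed
    have pq: ?thesis if p: "prime p" "prime q" "p < q" "v = int p * int q" for p q :: nat
    proof -
      have "\<not> v dvd int p"
        unfolding p(4) using p prime_gt_0_nat[OF p(1)] prime_gt_1_nat[OF p(2)] by simp
      then show ?thesis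
        using conj_into_translations_pq[OF p(4,1,2,3) w] w_one p(4) by (metis dvd_refl of_nat_mult)
    qed
    show ?thesis
      using cases
    proof (elim disjE exE conjE)
      fix p q :: nat assume p: "prime p" "prime q" "v = int p * int q"
      consider "p < q" | "p = q" | "q < p" by linarith
      then show ?thesis
      proof cases
        case 2
        \<comment> \<open>The square of a prime is handled as a prime power.\<close>
        then show ?thesis using pp[of p 2] p by (simp add: power2_eq_square)
      qed (use p pq mult.commute in metis)+
    qed (use pp in blast)
  qed
  then obtain g t where g: "g \<in> carrier A" "g \<otimes>\<^bsub>A\<^esub> w \<otimes>\<^bsub>A\<^esub> inv\<^bsub>A\<^esub> g = transl v t" by blast
  let ?i = "inv\<^bsub>A\<^esub> g"
  have ic: "?i \<in> carrier A" using g(1) by (rule inv_closed)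
  have wi: "w \<otimes>\<^bsub>A\<^esub> ?i = ?i \<otimes>\<^bsub>A\<^esub> transl v t"
    unfolding g(2)[symmetric] using g(1) w ic by (metis inv_inv inv_solve_left m_assoc m_closed)
  define f where "f = fst h \<circ> fst ?i"
  define l where "l = snd h \<circ> snd ?i"
  have "(f, l) \<in> inc_iso v S T"
    unfolding f_def l_def using inc_iso_comp[of ?i v S S h T] h ic by (simp add: carrier_aut_group)
  note fl = inc_isoD[OF this, simplified]
  have step: "[f (x + t) = f x + 1] (mod v)" for x
  proof -
    have "fst w (fst ?i x) = fst ?i ((x + t) mod v)"
      using arg_cong[OF wi, of "\<lambda>u. fst u x"] by simp
    then have "fst h' ((f x + 1) mod v) = fst ?i (x + t)"
      using A_zperm(1)[OF ic] unfolding w_def W_def f_def by simp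
    then have "fst h (fst h' ((f x + 1) mod v)) = f (x + t)" unfolding f_def by simp
    then show ?thesis unfolding h'(3) by (metis cong_def mod_mod_trivial)
  qed
  have mult: "[f (t * m) = f 0 + m] (mod v)" for m
    using shift_multiple[where f = f and e = t and t = 1 and x = 0 and m = m, OF step] by simp
  \<comment> \<open>By \<open>mult\<close>, \<open>t * a\<close> and 1 have the same image under
    \<open>f\<close>, so the slope \<open>a\<close> inverts \<open>t\<close>.\<close>
  define a where "a = f 1 - f 0"
  have "[f (t * a) = f 1] (mod v)" using mult[of a] unfolding a_def by simp
  then have ta: "[t * a = 1] (mod v)" using zperm_cong_iff[OF fl(1)] by blast
  have aff: "[f x = a * x + f 0] (mod v)" for x
  proof -
    have "[t * (a * x) = 1 * x] (mod v)" using cong_mult[OF ta cong_refl[of x]] by (simp add: algebra_simps)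
    then have "[f x = f (t * (a * x))] (mod v)" using zperm_cong_iff[OF fl(1)] cong_sym by simp
    also have "[f (t * (a * x)) = f 0 + a * x] (mod v)" by (rule mult)
    finally show ?thesis by (simp add: add.commute)
  qed
  have "coprime a v" using ta by (metis coprime_iff_invertible_int mult.commute)
  moreover have "x \<in> S \<longleftrightarrow> a * x + (f 0 - l 0) \<in> T" for x
  proof -
    have "x \<in> S \<longleftrightarrow> f x - l 0 \<in> T" using fl(3)[of x 0] by simp
    also have "\<dots> \<longleftrightarrow> a * x + (f 0 - l 0) \<in> T"
      using cong_diff[OF aff[of x] cong_refl[of "l 0"]] by (intro periodic_setD[OF T]) (simp add: algebra_simps)
    finally show ?thesis .
  qed
  ultimately show ?thesis by blast
qed

section \<open>Reduction to connected configurations\<close>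

lemma (in sidon_set) diff_gcd_dvd_modulus: "diff_gcd S dvd v"
proof -
  obtain a where a: "a \<in> S" using base_points by blast
  then have "a + v \<in> S" using periodic_setD[OF periodic, of a "a + v"] by (simp add: cong_def)
  then show ?thesis using diff_gcd_dvd[of "a + v" S a] a by simp
qed

lemma (in sidon_set) diff_gcd_pos: "diff_gcd S > 0"
proof -
  have "diff_gcd S \<noteq> 0" using diff_gcd_dvd_modulus v_pos by auto
  moreover have "diff_gcd S \<ge> 0" unfolding diff_gcd_def by (rule Gcd_int_greater_eq_0)
  ultimately show ?thesis by simp
qed

text \<open>Isomorphisms map components into components: \<open>x\<close> and
  \<open>x + (s - t)\<close> lie on the line \<open>x - t\<close>, so their images lie on a common
  line of \<open>T\<close>.\<close>

lemma inc_iso_cong_diff_gcd: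
  assumes h: "h \<in> inc_iso v S T" and xy: "[x = y] (mod diff_gcd S)"
  shows "[fst h x = fst h y] (mod diff_gcd T)"
proof -
  have "fst h (x + (s - t)) mod diff_gcd T = fst h x mod diff_gcd T" if "s \<in> S" "t \<in> S" for x s t
  proof -
    have "fst h (x + (s - t)) - snd h (x - t) \<in> T" "fst h x - snd h (x - t) \<in> T"
      using that by (auto simp flip: inc_isoD(3)[OF h])
    from diff_gcd_dvd[OF this] show ?thesis by (simp add: mod_eq_dvd_iff)
  qed
  then show ?thesis
    unfolding cong_def by (rule period_diff_gcd[OF _ xy])
qed

text \<open>The gcd counts the components, and an isomorphism sends different components to
  different ones.\<close>

lemma inc_iso_diff_gcd_le:
  assumes S: "sidon_set v S" and T: "sidon_set v T" and h: "h \<in> inc_iso v S T"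
  shows "diff_gcd S \<le> diff_gcd T"
proof -
  interpret S: sidon_set v S by (rule S)
  interpret T: sidon_set v T by (rule T)
  obtain h' where h': "h' \<in> inc_iso v T S" "\<And>x. fst h' (fst h x) = x mod v"
    using inc_iso_inverse[OF h S.v_pos T.periodic] by metis
  have "inj_on (\<lambda>x. fst h x mod diff_gcd T) {0..<diff_gcd S}"
  proof (rule inj_onI)
    fix x y assume xy: "x \<in> {0..<diff_gcd S}" "y \<in> {0..<diff_gcd S}" "fst h x mod diff_gcd T = fst h y mod diff_gcd T"
    then have "[fst h' (fst h x) = fst h' (fst h y)] (mod diff_gcd S)"
      by (intro inc_iso_cong_diff_gcd[OF h'(1)]) (simp add: cong_def)
    then have "[x = y] (mod diff_gcd S)"
      unfolding h'(2) using S.diff_gcd_dvd_modulus by (simp add: cong_def mod_mod_cancel)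
    then show "x = y" using xy by (simp add: cong_def)
  qed
  moreover have "(\<lambda>x. fst h x mod diff_gcd T) ` {0..<diff_gcd S} \<subseteq> {0..<diff_gcd T}"
    using T.diff_gcd_pos by auto
  ultimately have "card {0..<diff_gcd S} \<le> card {0..<diff_gcd T}" by (rule card_inj_on_le) simp
  then show ?thesis using S.diff_gcd_pos T.diff_gcd_pos by simp
qed

text \<open>All elements of \<open>S\<close> are congruent modulo its gcd, so \<open>S\<close> is a
  rescaled and shifted copy of a set modulo \<open>m\<close>. The rescaling keeps the Sidon property
  and loses no points, and it divides the gcd of the differences by itself.\<close>

lemma (in sidon_set) quotient_connected:
  assumes m: "v = diff_gcd S * m" and s0: "s0 \<in> S"
  shows "connected_sidon_set m {x. diff_gcd S * x + s0 \<in> S}"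
proof -
  define d where "d = diff_gcd S"
  define S' where "S' = {x. d * x + s0 \<in> S}"
  have d: "d > 0" unfolding d_def by (rule diff_gcd_pos)
  have v: "v = d * m" using m unfolding d_def .
  have mpos: "m > 0" using v v_pos d by (simp add: zero_less_mult_iff)
  have up: "[d * x + s0 = d * y + s0] (mod v) \<longleftrightarrow> [x = y] (mod m)" for x y
    unfolding cong_add_rcancel unfolding v cong_iff_dvd_diff right_diff_distrib[symmetric] using d by simp
  have repr: "\<exists>x. x \<in> S' \<and> s = d * x + s0" if s: "s \<in> S" for s
  proof -
    obtain x where "s - s0 = d * x" using diff_gcd_dvd[OF s s0] unfolding d_def by blast
    then show ?thesis using s unfolding S'_def by (intro exI[of _ x]) (simp add: algebra_simps)
  qed
  have "connected_sidon_set m S'"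
  proof unfold_locales
    show "m > 0" by (rule mpos)
    show "periodic_set m S'"
      unfolding periodic_set_def S'_def using up periodic_setD[OF periodic] by blast
  next
    fix a b c e assume S': "a \<in> S'" "b \<in> S'" "c \<in> S'" "e \<in> S'" and eq: "[a - b = c - e] (mod m)"
    have "v dvd d * ((a - b) - (c - e))"
      using eq d unfolding v cong_iff_dvd_diff by simp
    then have "[(d * a + s0) - (d * b + s0) = (d * c + s0) - (d * e + s0)] (mod v)"
      by (simp add: cong_iff_dvd_diff algebra_simps)
    then have "[d * a + s0 = d * b + s0] (mod v) \<or> [d * a + s0 = d * c + s0] (mod v)"
      using S' unfolding S'_def by (intro sidon[where d = "d * e + s0"]) auto
    then show "[a = b] (mod m) \<or> [a = c] (mod m)" unfolding up .
  next
    define \<rho> where "\<rho> s = ((s - s0) div d) mod m" for s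
    have \<rho>: "[d * \<rho> s + s0 = s] (mod v)" if "s \<in> S" for s
    proof -
      have "d * ((s - s0) div d) + s0 = s" using diff_gcd_dvd[OF that s0] unfolding d_def by simp
      moreover have "[d * \<rho> s + s0 = d * ((s - s0) div d) + s0] (mod v)"
        unfolding up \<rho>_def by (simp add: cong_def)
      ultimately show ?thesis by simp
    qed
    have "inj_on \<rho> (S \<inter> {0..<v})"
    proof (rule inj_onI)
      fix s t assume st: "s \<in> S \<inter> {0..<v}" "t \<in> S \<inter> {0..<v}" "\<rho> s = \<rho> t"
      then have "[s = t] (mod v)" using \<rho>[of s] \<rho>[of t] cong_trans cong_sym by (metis Int_iff)
      then show "s = t" using st by (simp add: cong_def)
    qed
    moreover have "\<rho> ` (S \<inter> {0..<v}) \<subseteq> S' \<inter> {0..<m}"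
    proof
      fix z assume "z \<in> \<rho> ` (S \<inter> {0..<v})"
      then obtain s where s: "s \<in> S" "z = \<rho> s" by blast
      then have "d * z + s0 \<in> S" using \<rho>[of s] periodic_setD[OF periodic] by blast
      then show "z \<in> S' \<inter> {0..<m}" using s mpos unfolding S'_def \<rho>_def by simp
    qed
    ultimately have "card (S \<inter> {0..<v}) \<le> card (S' \<inter> {0..<m})" by (rule card_inj_on_le) simp
    then show "3 \<le> card (S' \<inter> {0..<m})" using card_ge_3 by simp
  next
    have "diff_gcd S * diff_gcd S' dvd diff_gcd S"
      unfolding diff_gcd_def[of S]
    proof (rule Gcd_greatest)
      fix z assume "z \<in> {s - t |s t. s \<in> S \<and> t \<in> S}"
      then obtain s t where "s \<in> S" "t \<in> S" "z = s - t" by blast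
      then obtain x y where xy: "x \<in> S'" "y \<in> S'" "z = d * (x - y)"
        using repr[of s] repr[of t] by (auto simp: algebra_simps)
      then show "Gcd {s - t |s t. s \<in> S \<and> t \<in> S} * diff_gcd S' dvd z"
        using diff_gcd_dvd[OF xy(1,2)] unfolding xy(3) d_def diff_gcd_def[of S] by simp
    qed
    then have "diff_gcd S' dvd 1" using diff_gcd_pos by simp
    then show "diff_gcd S' = 1" unfolding diff_gcd_def by (simp add: Gcd_int_greater_eq_0)
  qed
  then show ?thesis unfolding S'_def d_def .
qed

text \<open>A permutation sending the class of \<open>r\<close> modulo \<open>d\<close> into the
  class of \<open>c\<close> induces a permutation modulo \<open>m\<close> once both classes are
  rescaled by \<open>d\<close>.\<close>

lemma zperm_descend:
  assumes g: "g \<in> zperm (d * m)" and d: "d > 0" and m: "m > 0"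
    and c: "\<And>x. [g (d * x + r) = c] (mod d)"
  defines "g' \<equiv> \<lambda>x. ((g (d * x + r) - c) div d) mod m"
  shows "g' \<in> zperm m" "[d * g' x + c = g (d * x + r)] (mod d * m)"
proof -
  have up: "[d * x + c = d * y + c] (mod d * m) \<longleftrightarrow> [x = y] (mod m)" for x y c
    unfolding cong_add_rcancel unfolding cong_iff_dvd_diff right_diff_distrib[symmetric] using d by simp
  have eq: "[d * g' x + c = g (d * x + r)] (mod d * m)" for x
  proof -
    have "d * ((g (d * x + r) - c) div d) + c = g (d * x + r)"
      using c[of x] by (simp add: cong_iff_dvd_diff)
    moreover have "[d * g' x + c = d * ((g (d * x + r) - c) div d) + c] (mod d * m)"
      unfolding up g'_def by (simp add: cong_def)
    ultimately show ?thesis by simp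
  qed
  show "[d * g' x + c = g (d * x + r)] (mod d * m)" by (rule eq)
  have "g' x = g' y \<longleftrightarrow> [x = y] (mod m)" for x y
  proof -
    have "g' x = g' y \<longleftrightarrow> [g' x = g' y] (mod m)" unfolding g'_def by (simp add: cong_def)
    also have "\<dots> \<longleftrightarrow> [d * g' x + c = d * g' y + c] (mod d * m)" by (simp only: up)
    also have "\<dots> \<longleftrightarrow> [g (d * x + r) = g (d * y + r)] (mod d * m)"
      using eq[of x] eq[of y] by (metis cong_def)
    also have "\<dots> \<longleftrightarrow> [x = y] (mod m)" by (simp only: zperm_cong_iff[OF g] up)
    finally show ?thesis .
  qed
  then show "g' \<in> zperm m" using m unfolding zperm_def g'_def by simp
qed

text \<open>Units modulo \<open>m\<close> lift to units modulo \<open>v\<close> when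
  \<open>m\<close> divides \<open>v\<close>. For \<open>k\<close> the product of the prime factors
  of \<open>v\<close> not dividing \<open>a\<close>, each prime factor of \<open>v\<close> divides
  exactly one of \<open>a\<close> and \<open>m * k\<close>.\<close>

lemma coprime_lift:
  fixes a m v :: int
  assumes "coprime a m" "v \<noteq> 0"
  obtains k where "coprime (a + m * k) v"
proof -
  define F where "F = {p \<in> prime_factors v. \<not> p dvd a}"
  define k where "k = \<Prod>F"
  have F: "finite F" "\<And>p. p \<in> F \<Longrightarrow> prime p" unfolding F_def by auto
  have "coprime (a + m * k) v"
  proof (rule ccontr)
    assume "\<not> coprime (a + m * k) v"
    then have "gcd (a + m * k) v \<noteq> 1" by (simp add: coprime_iff_gcd_eq_1)
    then obtain p where p: "prime p" "p dvd gcd (a + m * k) v"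
      using assms(2) prime_factor_int[of "gcd (a + m * k) v"] by auto
    then have pf: "p \<in> prime_factors v" using assms(2) by (simp add: in_prime_factors_iff)
    show False
    proof (cases "p dvd a")
      case True
      then have "p dvd m * k" using p by (simp add: dvd_add_right_iff)
      moreover have "\<not> p dvd m" using True assms(1) p(1) by (metis coprime_common_divisor not_prime_unit)
      ultimately have "p dvd k" using p(1) prime_dvd_mult_iff by blast
      then obtain r where r: "r \<in> F" "p dvd r"
        unfolding k_def using prime_dvd_prod_iff[OF F(1) p(1)] by auto
      then have "p = r" using primes_dvd_imp_eq p(1) F(2) by blast
      then show False using r(1) True unfolding F_def by blast
    next
      case False
      then have "p \<in> F" using pf unfolding F_def by blast
      then have "p dvd k" unfolding k_def using F(1) dvd_prodI by blast
      then show False using False p by (simp add: dvd_add_left_iff)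
    qed
  qed
  then show thesis by (rule that)
qed

text \<open>The isomorphism is restricted to the component of 0 and rescaled. The affine map found
  there is lifted to modulus \<open>v\<close>; it need not agree with \<open>h\<close>, as it only
  has to carry \<open>S\<close> to \<open>T\<close>.\<close>

lemma sidon_iso_imp_affine:
  assumes S: "sidon_set v S" and T: "sidon_set v T" and h: "h \<in> inc_iso v S T"
    and cases: "(\<exists>p q :: nat. prime p \<and> prime q \<and> v = int p * int q) \<or>
      (\<exists>p n :: nat. prime p \<and> n \<ge> 1 \<and> v = int p ^ n)"
  shows "\<exists>a b. coprime a v \<and> (\<forall>x. x \<in> S \<longleftrightarrow> a * x + b \<in> T)"
proof -
  interpret S: sidon_set v S by (rule S)
  interpret T: sidon_set v T by (rule T)
  obtain h' where h': "h' \<in> inc_iso v T S"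
    using inc_iso_inverse[OF h S.v_pos T.periodic] by metis
  define d where "d = diff_gcd S"
  have dT: "d = diff_gcd T"
    unfolding d_def using inc_iso_diff_gcd_le[OF S T h] inc_iso_diff_gcd_le[OF T S h'] by simp
  have d: "d > 0" unfolding d_def by (rule S.diff_gcd_pos)
  obtain m where v: "v = d * m" using S.diff_gcd_dvd_modulus unfolding d_def by blast
  have mpos: "m > 0" using v S.v_pos d by (simp add: zero_less_mult_iff)
  obtain s0 where s0: "s0 \<in> S" using S.base_points by blast
  obtain t0 where t0: "t0 \<in> T" using T.base_points by blast
  define S' where "S' = {x. d * x + s0 \<in> S}"
  define T' where "T' = {x. d * x + t0 \<in> T}"
  interpret S': connected_sidon_set m S'
    unfolding S'_def d_def by (rule S.quotient_connected) (use v s0 in \<open>auto simp: d_def\<close>)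
  interpret T': connected_sidon_set m T'
    unfolding T'_def dT by (rule T.quotient_connected) (use v t0 in \<open>auto simp: dT\<close>)
  note hz = inc_isoD(1,2)[OF h, unfolded v]
  have fc: "[fst h (d * x + 0) = fst h 0] (mod d)" for x
    using inc_iso_cong_diff_gcd[OF h, of "d * x" 0] unfolding dT[symmetric] d_def[symmetric] by (simp add: cong_def)
  \<comment> \<open>The line \<open>d * x - s0\<close> passes through the point
    \<open>d * x\<close>, so it belongs to the component of 0.\<close>
  have lc: "[snd h (d * x + (- s0)) = fst h 0 - t0] (mod d)" for x
  proof -
    have "fst h (d * x) - snd h (d * x + (- s0)) \<in> T"
      using s0 by (simp flip: inc_isoD(3)[OF h])
    then have "d dvd (fst h (d * x) - snd h (d * x + (- s0))) - t0"
      unfolding dT using t0 by (intro diff_gcd_dvd)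
    then have "d dvd (fst h (d * x + 0) - fst h 0) - ((fst h (d * x) - snd h (d * x + (- s0))) - t0)"
      using fc[of x] unfolding cong_iff_dvd_diff by (rule dvd_diff[rotated])
    then show ?thesis by (simp add: cong_iff_dvd_diff algebra_simps)
  qed
  define f' where "f' x = ((fst h (d * x + 0) - fst h 0) div d) mod m" for x
  define l' where "l' x = ((snd h (d * x + (- s0)) - (fst h 0 - t0)) div d) mod m" for x
  note f' = zperm_descend[OF hz(1) d mpos fc, folded f'_def]
  note l' = zperm_descend[OF hz(2) d mpos lc, folded l'_def]
  have "(f', l') \<in> inc_iso m S' T'"
  proof (rule inc_isoI)
    show "f' \<in> zperm m" using f'(1) by (simp add: f'_def[abs_def])
    show "l' \<in> zperm m" using l'(1) by (simp add: l'_def[abs_def])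
    fix x y
    have "x - y \<in> S' \<longleftrightarrow> d * x - (d * y + (- s0)) \<in> S" unfolding S'_def by (simp add: algebra_simps)
    also have "\<dots> \<longleftrightarrow> fst h (d * x + 0) - snd h (d * y + (- s0)) \<in> T" using inc_isoD(3)[OF h, of "d * x" "d * y + (- s0)"] by simp
    also have "\<dots> \<longleftrightarrow> (d * f' x + fst h 0) - (d * l' y + (fst h 0 - t0)) \<in> T"
      using cong_diff[OF f'(2)[of x] l'(2)[of y]] unfolding v[symmetric]
      by (intro periodic_setD[OF T.periodic]) (rule cong_sym)
    also have "\<dots> \<longleftrightarrow> f' x - l' y \<in> T'" unfolding T'_def by (simp add: algebra_simps)
    finally show "x - y \<in> S' \<longleftrightarrow> f' x - l' y \<in> T'" .
  qed
  moreover have "(\<exists>p q :: nat. prime p \<and> prime q \<and> m = int p * int q) \<or>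
      (\<exists>p n :: nat. prime p \<and> n \<ge> 1 \<and> m = int p ^ n)"
  proof -
    \<comment> \<open>A base line with three points excludes modulus 1; every other divisor of
      \<open>v\<close> again has one of the two admissible forms.\<close>
    have m1: "m \<noteq> 1"
      using S'.card_ge_3 card_mono[of "{0..<m}" "S' \<inter> {0..<m}"] by auto
    define m' where "m' = nat m"
    have m': "m = int m'" "m' \<noteq> 1" unfolding m'_def using mpos m1 by auto
    have mv: "m dvd v" using v by simp
    show ?thesis
      using cases
    proof (elim disjE exE conjE)
      fix p n :: nat assume p: "prime p" "n \<ge> 1" "v = int p ^ n"
      then have "m' dvd p ^ n" using mv m'(1) by (metis int_dvd_int_iff of_nat_power)
      then obtain i where "m' = p ^ i" using divides_primepow_nat[OF p(1)] by blast
      then show ?thesis using m' p(1) by (intro disjI2 exI[of _ p] exI[of _ i]) (cases i; auto)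
    next
      fix p q :: nat assume p: "prime p" "prime q" "v = int p * int q"
      then have "m' dvd p * q" using mv m'(1) by (metis int_dvd_int_iff of_nat_mult)
      then obtain x y where xy: "m' = x * y" "x dvd p" "y dvd q" by (metis division_decomp)
      then have "x = 1 \<or> x = p" "y = 1 \<or> y = q" using p prime_nat_iff by auto
      then consider "m' = p" | "m' = q" | "m' = p * q" using xy m'(2) by auto
      then show ?thesis
      proof cases
        case 1
        then show ?thesis using p m' by (intro disjI2 exI[of _ p] exI[of _ 1]) auto
      next
        case 2
        then show ?thesis using p m' by (intro disjI2 exI[of _ q] exI[of _ 1]) auto
      next
        case 3
        then show ?thesis using p m' by (intro disjI1 exI[of _ p] exI[of _ q]) auto
      qed
    qed
  qed
  ultimately obtain a b where ab: "coprime a m" "\<And>x. x \<in> S' \<longleftrightarrow> a * x + b \<in> T'"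
    using S'.iso_imp_affine[OF T'.periodic] by blast
  obtain k where k: "coprime (a + m * k) v" using coprime_lift[OF ab(1)] S.v_pos by (metis less_irrefl)
  define a' where "a' = a + m * k"
  \<comment> \<open>This constant makes the map send \<open>d * y + s0\<close> to
    \<open>d * (a * y + b) + t0\<close> modulo \<open>v\<close>.\<close>
  define B where "B = d * b + t0 - a' * s0"
  have "x \<in> S \<longleftrightarrow> a' * x + B \<in> T" for x
  proof (cases "d dvd x - s0")
    case True
    then obtain y where "x - s0 = d * y" by blast
    then have x: "x = d * y + s0" by simp
    have "x \<in> S \<longleftrightarrow> d * (a * y + b) + t0 \<in> T" using ab(2)[of y] unfolding x S'_def T'_def by simp
    also have "\<dots> \<longleftrightarrow> a' * x + B \<in> T"
      by (rule periodic_setD[OF T.periodic]) (simp add: x B_def a'_def v cong_iff_dvd_diff algebra_simps)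
    finally show ?thesis .
  next
    case False
    then have "x \<notin> S" using diff_gcd_dvd[OF _ s0] unfolding d_def by blast
    moreover have "a' * x + B \<notin> T"
    proof
      assume "a' * x + B \<in> T"
      then have "d dvd a' * x + B - t0" unfolding dT using t0 by (intro diff_gcd_dvd)
      then have "d dvd a' * (x - s0) + d * b" by (simp add: B_def algebra_simps)
      then have "d dvd a' * (x - s0)" by (simp add: dvd_add_left_iff)
      moreover have "coprime d a'" using k v unfolding a'_def by (simp add: coprime_commute)
      ultimately show False using False by (simp add: coprime_dvd_mult_right_iff)
    qed
    ultimately show ?thesis by blast
  qed
  then show ?thesis using k unfolding a'_def by blast
qed

section \<open>Cyclic configurations\<close>

definition line_of :: "int \<Rightarrow> int set \<Rightarrow> int \<Rightarrow> int set" where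
  "line_of v S y = {x \<in> {0..<v}. x - y \<in> S}"

definition shift_set :: "int \<Rightarrow> int \<Rightarrow> int set \<Rightarrow> int set" where
  "shift_set v t L = (\<lambda>x. (x + t) mod v) ` L"

lemma mem_shift_set:
  assumes "v > 0" "L \<subseteq> {0..<v}"
  shows "x \<in> shift_set v t L \<longleftrightarrow> x \<in> {0..<v} \<and> (x - t) mod v \<in> L"
proof
  assume "x \<in> shift_set v t L"
  then obtain z where z: "z \<in> L" "x = (z + t) mod v" unfolding shift_set_def by blast
  then have "(x - t) mod v = z mod v" by (simp add: mod_diff_left_eq)
  also have "\<dots> = z" using z(1) assms(2) by auto
  finally show "x \<in> {0..<v} \<and> (x - t) mod v \<in> L" using z assms(1) by simp
next
  assume "x \<in> {0..<v} \<and> (x - t) mod v \<in> L"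
  then show "x \<in> shift_set v t L" unfolding shift_set_def
    by (intro image_eqI[of _ _ "(x - t) mod v"]) (simp_all add: mod_add_left_eq)
qed

lemma card_torsion_le:
  fixes v :: int
  assumes "v > 0" "k > 0"
  shows "card {x \<in> {0..<v}. v dvd int k * x} \<le> k"
proof -
  have "inj_on (\<lambda>x. int k * x div v) {x \<in> {0..<v}. v dvd int k * x}"
    by (rule inj_onI) (use assms in \<open>auto simp: dvd_div_eq_iff\<close>)
  moreover have "(\<lambda>x. int k * x div v) ` {x \<in> {0..<v}. v dvd int k * x} \<subseteq> {0..<int k}"
  proof clarify
    fix x assume x: "x \<in> {0..<v}" "v dvd int k * x"
    then obtain y where y: "int k * x = v * y" by blast
    have "0 \<le> v * y" unfolding y[symmetric] using x by simp
    moreover have "v * y < v * int k"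
      unfolding y[symmetric] using x assms by (simp add: mult.commute[of v])
    ultimately show "int k * x div v \<in> {0..<int k}"
      using assms(1) by (simp add: y zero_le_mult_iff)
  qed
  ultimately have "card {x \<in> {0..<v}. v dvd int k * x} \<le> card {0..<int k}"
    by (rule card_inj_on_le) simp
  then show ?thesis by simp
qed

text \<open>A line fixed by no nontrivial translation has \<open>v\<close> different translates, and
  these are all the lines. The bound on intersections becomes the Sidon property of this
  line.\<close>

lemma cyclic_configuration_base_line:
  assumes v: "v > 0" and cyc: "balanced_cyclic_configuration v \<B>"
  obtains S where "sidon_set (int v) S" "\<B> = range (line_of (int v) S)"
proof -
  let ?v = "int v"
  have car: "carrier (Zmod v) = {0..<?v}" by (auto simp: residue_ring_def)
  obtain k where conf: "balanced_configuration v k {0..<?v} \<B>"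
    using cyc unfolding balanced_cyclic_configuration_def car by blast
  have k3: "k \<ge> 3" and cardB: "card \<B> = v" and sub: "\<And>L. L \<in> \<B> \<Longrightarrow> L \<subseteq> {0..<?v}"
    and meet: "\<And>L M. \<lbrakk>L \<in> \<B>; M \<in> \<B>; L \<noteq> M\<rbrakk> \<Longrightarrow> card (L \<inter> M) \<le> 1"
    and cardL: "\<And>L. L \<in> \<B> \<Longrightarrow> card L = k"
    and deg: "\<And>x. x \<in> {0..<?v} \<Longrightarrow> card {L \<in> \<B>. x \<in> L} = k"
    using conf unfolding balanced_configuration_def by auto
  have finL: "finite L" if "L \<in> \<B>" for L using sub[OF that] finite_subset by blast
  have meetI: "L = M" if "L \<in> \<B>" "M \<in> \<B>" "x \<in> L" "x \<in> M" "y \<in> L" "y \<in> M" "x \<noteq> y" for L M x y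
  proof (rule ccontr)
    assume "L \<noteq> M"
    then have "card (L \<inter> M) \<le> Suc 0" using meet that by simp
    then show False using that finL card_le_Suc0_iff_eq[of "L \<inter> M"] by auto
  qed
  have "(\<lambda>L. (\<lambda>x. (x + 1) mod ?v) ` L) ` \<B> = \<B>"
  proof -
    have "(\<lambda>x. x \<oplus>\<^bsub>Zmod v\<^esub> \<one>\<^bsub>Zmod v\<^esub>) ` L = (\<lambda>x. (x + 1) mod ?v) ` L" for L
      by (simp add: residue_ring_def mod_add_right_eq)
    then show ?thesis
      using cyc unfolding balanced_cyclic_configuration_def configuration_isomorphism_def by simp
  qed
  then have shift1: "shift_set ?v 1 L \<in> \<B>" if "L \<in> \<B>" for L
    using that unfolding shift_set_def by blast
  have shift_nat: "shift_set ?v (int n) L \<in> \<B>" if L: "L \<in> \<B>" for n L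
  proof (induction n)
    case 0
    have "shift_set ?v 0 L = L" using mem_shift_set[OF _ sub[OF L], where t = 0] sub[OF L] v by auto
    then show ?case using L by simp
  next
    case (Suc n)
    have "shift_set ?v (int (Suc n)) L = shift_set ?v 1 (shift_set ?v (int n) L)"
      unfolding shift_set_def image_image by (simp add: mod_simps ac_simps)
    then show ?case using shift1[OF Suc] by simp
  qed
  have shift_mod: "shift_set ?v (t mod ?v) L = shift_set ?v t L" for t L
    unfolding shift_set_def by (simp add: mod_add_right_eq)
  have shift: "shift_set ?v t L \<in> \<B>" if "L \<in> \<B>" for t L
    using shift_nat[OF that, of "nat (t mod ?v)"] v by (simp add: shift_mod)
  \<comment> \<open>Otherwise every line is a coset of the subgroup of order \<open>k\<close>, and only one of these contains 0.\<close>
  have "\<exists>L\<in>\<B>. \<forall>t. shift_set ?v t L = L \<longrightarrow> ?v dvd t"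
  proof (rule ccontr)
    assume "\<not> ?thesis"
    then have stab: "\<exists>t. \<not> ?v dvd t \<and> shift_set ?v t L = L" if "L \<in> \<B>" for L using that by blast
    \<comment> \<open>The points \<open>y\<close> and \<open>y + t\<close> lie on \<open>L\<close>
      and also on its translate by \<open>y - x\<close>, being the translates of \<open>x\<close>
      and \<open>x + t\<close>. Two common points force the two lines to coincide.\<close>
    have coset: "shift_set ?v (y - x) L = L" if L: "L \<in> \<B>" "x \<in> L" "y \<in> L" for L x y
    proof -
      obtain t where t: "\<not> ?v dvd t" "shift_set ?v t L = L" using stab[OF L(1)] by blast
      have xt: "(z + t) mod ?v \<in> L" if "z \<in> L" for z
        using that t(2) unfolding shift_set_def by blast
      have xy: "x \<in> {0..<?v}" "y \<in> {0..<?v}" using L sub[OF L(1)] by auto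
      have "y = (x + (y - x)) mod ?v" using xy by simp
      then have 1: "y \<in> shift_set ?v (y - x) L" unfolding shift_set_def using L(2) by blast
      have "(y + t) mod ?v = ((x + t) mod ?v + (y - x)) mod ?v"
        unfolding mod_add_left_eq by (simp add: algebra_simps)
      then have 2: "(y + t) mod ?v \<in> shift_set ?v (y - x) L" unfolding shift_set_def using xt[OF L(2)] by blast
      have "(y + t) mod ?v \<noteq> y"
      proof
        assume "(y + t) mod ?v = y"
        then have "[y + t = y] (mod ?v)" using xy by (simp add: cong_def)
        then show False using t(1) by (simp add: cong_iff_dvd_diff)
      qed
      then show ?thesis
        using meetI[OF shift[OF L(1)] L(1) 1 L(3) 2 xt[OF L(3)]] by simp
    qed
    let ?Z = "{x \<in> {0..<?v}. ?v dvd int k * x}"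
    have "L = ?Z" if L: "L \<in> \<B>" "0 \<in> L" for L
    proof (rule card_seteq)
      show "finite ?Z" by (rule finite_subset[of _ "{0..<?v}"]) auto
      show "card ?Z \<le> card L" using card_torsion_le[of ?v k] cardL[OF L(1)] v k3 by simp
      show "L \<subseteq> ?Z"
      proof
        \<comment> \<open>Translation by \<open>x\<close> permutes \<open>L\<close>; comparing the
          sums of its elements before and after shows that \<open>k * x\<close> vanishes modulo
          \<open>v\<close>.\<close>
        fix x assume x: "x \<in> L"
        have im: "(\<lambda>z. (z + x) mod ?v) ` L = L"
          using coset[OF L x] unfolding shift_set_def by simp
        have "inj_on (\<lambda>z. (z + x) mod ?v) L"
          using im finL[OF L(1)] by (simp add: eq_card_imp_inj_on)
        then have "(\<Sum>z\<in>L. (z + x) mod ?v) = (\<Sum>z\<in>L. z)"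
          using im sum.reindex[of "\<lambda>z. (z + x) mod ?v" L "\<lambda>z. z"] by simp
        moreover have "[(\<Sum>z\<in>L. (z + x) mod ?v) = (\<Sum>z\<in>L. z + x)] (mod ?v)"
          by (rule cong_sum) (simp add: cong_def)
        ultimately have "?v dvd int k * x"
          using cardL[OF L(1)] by (simp add: sum.distrib cong_iff_dvd_diff)
        then show "x \<in> ?Z" using x sub[OF L(1)] by blast
      qed
    qed
    then have "{L \<in> \<B>. 0 \<in> L} \<subseteq> {?Z}" by blast
    then have "card {L \<in> \<B>. 0 \<in> L} \<le> 1" using card_mono[of "{?Z}"] by fastforce
    then show False using deg[of 0] v k3 by simp
  qed
  then obtain L where L: "L \<in> \<B>" and stab: "\<And>t. shift_set ?v t L = L \<Longrightarrow> ?v dvd t" by blast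
  define S where "S = {x. x mod ?v \<in> L}"
  have line: "line_of ?v S y = shift_set ?v y L" for y
    using mem_shift_set[OF _ sub[OF L], of _ y] v unfolding line_of_def S_def by auto
  have eqL: "[s = t] (mod ?v)" if "shift_set ?v s L = shift_set ?v t L" for s t
  proof -
    have "shift_set ?v (s - t) L = L"
    proof (rule Set.set_eqI)
      fix x
      have "((x + t) mod ?v - s) mod ?v = (x - (s - t)) mod ?v"
        unfolding mod_diff_left_eq by (simp add: algebra_simps)
      then have "x \<in> shift_set ?v (s - t) L \<longleftrightarrow> x \<in> {0..<?v} \<and> (x + t) mod ?v \<in> shift_set ?v s L"
        using mem_shift_set[OF _ sub[OF L]] v by simp
      also have "\<dots> \<longleftrightarrow> x \<in> {0..<?v} \<and> x mod ?v \<in> L"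
        unfolding that using mem_shift_set[OF _ sub[OF L]] v by (simp add: mod_diff_left_eq)
      also have "\<dots> \<longleftrightarrow> x \<in> L" using sub[OF L] by auto
      finally show "x \<in> shift_set ?v (s - t) L \<longleftrightarrow> x \<in> L" .
    qed
    then show ?thesis using stab by (simp add: cong_iff_dvd_diff)
  qed
  have B: "\<B> = range (line_of ?v S)"
  proof -
    have "inj_on (\<lambda>t. shift_set ?v t L) {0..<?v}"
      by (rule inj_onI) (drule eqL, simp add: cong_def)
    then have "card ((\<lambda>t. shift_set ?v t L) ` {0..<?v}) = card \<B>" using cardB by (simp add: card_image)
    moreover have "finite \<B>" using cardB v by (intro card_ge_0_finite) simp
    ultimately have "(\<lambda>t. shift_set ?v t L) ` {0..<?v} = \<B>"
      using shift[OF L] by (intro card_subset_eq) auto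
    moreover have "range (line_of ?v S) \<subseteq> \<B>" unfolding line using shift[OF L] by blast
    ultimately show ?thesis unfolding line by blast
  qed
  have "sidon_set ?v S"
  proof
    show "?v > 0" using v by simp
    show "periodic_set ?v S" unfolding periodic_set_def S_def cong_def by simp
    have "S \<inter> {0..<?v} = L" unfolding S_def using sub[OF L] by auto
    then show "3 \<le> card (S \<inter> {0..<?v})" using cardL[OF L] k3 by simp
  next
    fix a b c d assume abcd: "a \<in> S" "b \<in> S" "c \<in> S" "d \<in> S" "[a - b = c - d] (mod ?v)"
    show "[a = b] (mod ?v) \<or> [a = c] (mod ?v)"
    proof (rule disjCI)
      assume "\<not> [a = c] (mod ?v)"
      then have ne: "shift_set ?v (a - c) L \<noteq> L" using stab by (auto simp: cong_iff_dvd_diff)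
      \<comment> \<open>This places \<open>b\<close> on the translate of \<open>L\<close> by
        \<open>a - c\<close>; \<open>a\<close> lies there because \<open>c\<close> is in
        \<open>S\<close>.\<close>
      have "b - (a - c) - d = - ((a - b) - (c - d))" by simp
      then have "[b - (a - c) = d] (mod ?v)"
        using abcd(5) unfolding cong_iff_dvd_diff by (simp only: dvd_minus_iff)
      then have "a mod ?v \<in> shift_set ?v (a - c) L" "b mod ?v \<in> shift_set ?v (a - c) L"
        using abcd v mem_shift_set[OF _ sub[OF L]] unfolding S_def by (simp_all add: mod_diff_left_eq cong_def)
      moreover have "a mod ?v \<in> L" "b mod ?v \<in> L" using abcd unfolding S_def by auto
      ultimately have "a mod ?v = b mod ?v" using meetI[OF shift[OF L] L] ne by blast
      then show "[a = b] (mod ?v)" by (simp add: cong_def)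
    qed
  qed
  then show thesis using B by (rule that)
qed

section \<open>Configuration isomorphisms, incidence isomorphisms and multipliers\<close>

lemma (in sidon_set) line_of_eq_iff: "line_of v S y = line_of v S z \<longleftrightarrow> [y = z] (mod v)"
proof
  assume eq: "line_of v S y = line_of v S z"
  have "v dvd y - z"
  proof (rule translation_stabilizer_trivial)
    fix s assume "s \<in> S"
    then have "(s + y) mod v \<in> line_of v S y"
      using v_pos periodic_setD[OF periodic, of "(s + y) mod v - y" s]
      by (simp add: line_of_def cong_def mod_diff_left_eq)
    then have "(s + y) mod v \<in> line_of v S z" using eq by simp
    then have "(s + y) mod v - z \<in> S" by (simp add: line_of_def)
    then show "s + (y - z) \<in> S"
      using periodic_setD[OF periodic, of "(s + y) mod v - z" "s + (y - z)"]
      by (simp add: cong_def mod_diff_left_eq algebra_simps)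
  qed
  then show "[y = z] (mod v)" by (simp add: cong_iff_dvd_diff)
next
  assume "[y = z] (mod v)"
  then have "x - y \<in> S \<longleftrightarrow> x - z \<in> S" for x
    by (intro periodic_setD[OF periodic] cong_diff cong_refl)
  then show "line_of v S y = line_of v S z" by (simp add: line_of_def)
qed

lemma isomorphism_imp_inc_iso:
  assumes S: "sidon_set v S" and T: "sidon_set v T"
    and f: "bij_betw f {0..<v} {0..<v}" "(\<lambda>L. f ` L) ` range (line_of v S) = range (line_of v T)"
  obtains h where "h \<in> inc_iso v S T"
proof -
  interpret S: sidon_set v S by (rule S)
  interpret T: sidon_set v T by (rule T)
  note v = S.v_pos
  have f_in: "f (x mod v) \<in> {0..<v}" for x using bij_betw_apply[OF f(1), of "x mod v"] v by simp
  have f_inj: "f (x mod v) = f (y mod v) \<longleftrightarrow> [x = y] (mod v)" for x y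
    using f(1) v by (auto simp: bij_betw_def inj_on_eq_iff cong_def)
  \<comment> \<open>The index of the image line in \<open>{0..<v}\<close> is unique, and reducing
    \<open>y\<close> first makes \<open>l\<close> periodic.\<close>
  define l where "l y = (SOME z. z \<in> {0..<v} \<and> f ` line_of v S (y mod v) = line_of v T z)" for y
  have l: "l y \<in> {0..<v} \<and> f ` line_of v S (y mod v) = line_of v T (l y)" for y
  proof -
    have "f ` line_of v S (y mod v) \<in> range (line_of v T)" using f(2) by blast
    then obtain z where "f ` line_of v S (y mod v) = line_of v T z" by blast
    then have "z mod v \<in> {0..<v} \<and> f ` line_of v S (y mod v) = line_of v T (z mod v)"
      using T.line_of_eq_iff[of z "z mod v"] v by (simp add: cong_def)
    then show ?thesis unfolding l_def by (rule someI)
  qed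
  have fline: "f ` line_of v S y = line_of v T (l y)" for y
    using l[of y] S.line_of_eq_iff[of y "y mod v"] by (simp add: cong_def)
  have "(\<lambda>x. f (x mod v)) \<in> zperm v" using f_in f_inj by (simp add: zperm_def)
  moreover have "l \<in> zperm v"
  proof -
    have "l y = l z \<longleftrightarrow> [y = z] (mod v)" for y z
    proof
      assume "l y = l z"
      then have "f ` line_of v S y = f ` line_of v S z" using fline by simp
      moreover have "line_of v S y \<subseteq> {0..<v}" "line_of v S z \<subseteq> {0..<v}" unfolding line_of_def by blast+
      ultimately have "line_of v S y = line_of v S z"
        using bij_betw_imp_inj_on[OF f(1)] inj_on_image_eq_iff by metis
      then show "[y = z] (mod v)" using S.line_of_eq_iff by simp
    next
      assume "[y = z] (mod v)"
      then show "l y = l z" unfolding l_def by (simp add: cong_def)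
    qed
    then show ?thesis using l by (simp add: zperm_def)
  qed
  moreover have "x - y \<in> S \<longleftrightarrow> f (x mod v) - l y \<in> T" for x y
  proof -
    have "x - y \<in> S \<longleftrightarrow> x mod v \<in> line_of v S y"
      using v periodic_setD[OF S.periodic, of "x mod v - y" "x - y"]
      by (simp add: line_of_def cong_def mod_diff_left_eq)
    also have "\<dots> \<longleftrightarrow> f (x mod v) \<in> f ` line_of v S y"
    proof -
      have "line_of v S y \<subseteq> {0..<v}" unfolding line_of_def by blast
      then show ?thesis
        using inj_on_image_mem_iff[OF bij_betw_imp_inj_on[OF f(1)], of "x mod v"] v by simp
    qed
    also have "\<dots> \<longleftrightarrow> f (x mod v) - l y \<in> T"
      using f_in[of x] unfolding fline by (simp add: line_of_def)
    finally show ?thesis .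
  qed
  ultimately have "((\<lambda>x. f (x mod v)), l) \<in> inc_iso v S T" by (rule inc_isoI)
  then show thesis by (rule that)
qed

text \<open>The constant term only renumbers the lines: multiplication by \<open>a\<close> sends
  line \<open>y\<close> of \<open>S\<close> to line \<open>a * y - b\<close> of \<open>T\<close>,
  and since \<open>a\<close> is a unit every line of \<open>T\<close> is reached.\<close>

lemma affine_imp_multiplier:
  assumes v: "v > 1" and T: "periodic_set v T" and a: "coprime a v"
    and ST: "\<And>x. x \<in> S \<longleftrightarrow> a * x + b \<in> T"
  shows "bij_betw (\<lambda>x. a * x mod v) {0..<v} {0..<v}"
    and "(\<lambda>L. (\<lambda>x. a * x mod v) ` L) ` range (line_of v S) = range (line_of v T)"
proof -
  obtain c where c: "[a * c = 1] (mod v)" using cong_solve_coprime_int[OF a] by blast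
  have ac: "[a * (c * x) = x] (mod v)" for x
    using cong_mult[OF c cong_refl[of x]] by (simp add: algebra_simps)
  have inj: "inj_on (\<lambda>x. a * x mod v) {0..<v}"
  proof (rule inj_onI)
    fix x y assume xy: "x \<in> {0..<v}" "y \<in> {0..<v}" "a * x mod v = a * y mod v"
    then have "[x = y] (mod v)" using a by (simp add: cong_mult_lcancel flip: cong_def)
    then show "x = y" using xy by (simp add: cong_def)
  qed
  then show bij: "bij_betw (\<lambda>x. a * x mod v) {0..<v} {0..<v}"
    unfolding bij_betw_def using v by (auto intro!: endo_inj_surj[OF _ _ inj] del: equalityI)
  have img: "(\<lambda>x. a * x mod v) ` line_of v S y = line_of v T (a * y - b)" for y
  proof -
    have mem: "a * x mod v \<in> line_of v T (a * y - b) \<longleftrightarrow> x \<in> line_of v S y" if "x \<in> {0..<v}" for x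
    proof -
      have "a * x mod v - (a * y - b) \<in> T \<longleftrightarrow> a * (x - y) + b \<in> T"
      proof (rule periodic_setD[OF T])
        have "[a * x mod v - (a * y - b) = a * x - (a * y - b)] (mod v)"
          by (intro cong_diff) (simp_all add: cong_def)
        then show "[a * x mod v - (a * y - b) = a * (x - y) + b] (mod v)" by (simp add: algebra_simps)
      qed
      then show ?thesis using that v ST[of "x - y"] by (simp add: line_of_def)
    qed
    show ?thesis
    proof (intro equalityI subsetI)
      fix z assume "z \<in> (\<lambda>x. a * x mod v) ` line_of v S y"
      then show "z \<in> line_of v T (a * y - b)" using mem unfolding line_of_def by blast
    next
      fix z assume z: "z \<in> line_of v T (a * y - b)"
      then have "z \<in> (\<lambda>x. a * x mod v) ` {0..<v}"
        using bij unfolding bij_betw_def line_of_def by blast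
      then show "z \<in> (\<lambda>x. a * x mod v) ` line_of v S y" using mem z by blast
    qed
  qed
  show "(\<lambda>L. (\<lambda>x. a * x mod v) ` L) ` range (line_of v S) = range (line_of v T)"
  proof -
    have "line_of v T z \<in> range (\<lambda>y. line_of v T (a * y - b))" for z
    proof -
      have "[a * (c * (z + b)) - b = z + b - b] (mod v)" using ac[of "z + b"] by (intro cong_diff) auto
      then have "x - z \<in> T \<longleftrightarrow> x - (a * (c * (z + b)) - b) \<in> T" for x
        by (intro periodic_setD[OF T] cong_diff) (auto intro: cong_sym)
      then have "line_of v T z = line_of v T (a * (c * (z + b)) - b)" unfolding line_of_def by simp
      then show ?thesis by blast
    qed
    then show ?thesis unfolding image_image img by blast
  qed
qed

theorem theoremB:
  fixes v :: nat and \<B> \<C> :: "int set set"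
  assumes "(\<exists>p q :: nat. prime p \<and> prime q \<and> v = p * q) \<or>
           (\<exists>p n :: nat. prime p \<and> n \<ge> 1 \<and> v = p ^ n)"
    and "balanced_cyclic_configuration v \<B>"
    and "balanced_cyclic_configuration v \<C>"
  shows "isomorphic_configurations (carrier (Zmod v)) \<B> (carrier (Zmod v)) \<C> \<longleftrightarrow>
         multiplier_equivalent v \<B> \<C>"
proof
  have car: "carrier (Zmod v) = {0..<int v}" by (auto simp: residue_ring_def)
  have v1: "v > 1"
    using assms(1)
  proof (elim disjE exE conjE)
    fix p q :: nat assume "prime p" "prime q" "v = p * q"
    then show ?thesis using prime_gt_1_nat less_1_mult by blast
  next
    fix p n :: nat assume "prime p" "n \<ge> 1" "v = p ^ n"
    then show ?thesis using prime_gt_1_nat one_less_power[of p n] by simp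
  qed
  assume "isomorphic_configurations (carrier (Zmod v)) \<B> (carrier (Zmod v)) \<C>"
  then obtain f where f: "bij_betw f {0..<int v} {0..<int v}" "(\<lambda>L. f ` L) ` \<B> = \<C>"
    unfolding isomorphic_configurations_def configuration_isomorphism_def car by blast
  obtain S where S: "sidon_set (int v) S" "\<B> = range (line_of (int v) S)"
    using cyclic_configuration_base_line[OF _ assms(2)] v1 by (metis gr_implies_not_zero neq0_conv)
  obtain T where T: "sidon_set (int v) T" "\<C> = range (line_of (int v) T)"
    using cyclic_configuration_base_line[OF _ assms(3)] v1 by (metis gr_implies_not_zero neq0_conv)
  obtain h where h: "h \<in> inc_iso (int v) S T"
    using isomorphism_imp_inc_iso[OF S(1) T(1) f(1)] f(2) unfolding S(2) T(2) by blast
  have "(\<exists>p q :: nat. prime p \<and> prime q \<and> int v = int p * int q) \<or>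
      (\<exists>p n :: nat. prime p \<and> n \<ge> 1 \<and> int v = int p ^ n)"
    using assms(1) by (metis of_nat_mult of_nat_power)
  then obtain a b where ab: "coprime a (int v)" "\<And>x. x \<in> S \<longleftrightarrow> a * x + b \<in> T"
    using sidon_iso_imp_affine[OF S(1) T(1) h] by blast
  interpret T: sidon_set "int v" T by (rule T(1))
  interpret R: residues "int v" "Zmod v" using v1 by unfold_locales auto
  have Tp: "periodic_set (int v) T" by (rule T.periodic)
  note mult = affine_imp_multiplier[OF _ Tp ab, unfolded S(2)[symmetric] T(2)[symmetric]]
  have eq: "(\<lambda>x. (a mod int v) \<otimes>\<^bsub>Zmod v\<^esub> x) = (\<lambda>x. a * x mod int v)"
    by (simp add: residue_ring_def mod_mult_left_eq)
  \<comment> \<open>The multiplier is reduced to its representative in the carrier, which is nonzero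
    as \<open>a\<close> is coprime to \<open>v > 1\<close>.\<close>
  have "a mod int v \<in> Units (Zmod v)"
    unfolding R.res_units_eq using ab(1) v1
    by (cases "a mod int v = 0") (auto simp: order.strict_iff_order[of 0] simp flip: coprime_mod_left_iff[of a "int v"])
  moreover have "configuration_isomorphism (carrier (Zmod v)) \<B> (carrier (Zmod v)) \<C>
      (\<lambda>x. (a mod int v) \<otimes>\<^bsub>Zmod v\<^esub> x)"
    unfolding configuration_isomorphism_def car eq using mult v1 by simp
  ultimately show "multiplier_equivalent v \<B> \<C>" unfolding multiplier_equivalent_def by blast
next
  assume "multiplier_equivalent v \<B> \<C>"
  then show "isomorphic_configurations (carrier (Zmod v)) \<B> (carrier (Zmod v)) \<C>"
    unfolding multiplier_equivalent_def isomorphic_configurations_def by blast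
qed

end
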